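(* Let $g$ be the accelerating Kerr-Newman-(anti-)de Sitter metric with real parameters $a,m,q,\Lambda,\alpha$ (see context). The spin coefficients $\mu=\varrho$ (with respect to the null tetrad in the context) vanish on the stationary horizons, i.e. at the real roots $r_0$ of $$Q(r)=(a^2+q^2-2mr+r^2)(1-\alpha^2r^2)-\tfrac13\Lambda(a^2+r^2)r^2,$$ and consequently the Page-Shoom invariant $W=\lVert d\Psi_2\wedge d\overline{\Psi}_2\rVert^2$ vanishes there as well.
   Context: Metric: in coordinates $(t,r,\theta,\phi)$, signature $(-,+,+,+)$, $$ds^2=\frac1{\Omega^2}\Big\{-\frac{Q}{\rho^2}\big[dt-a\sin^2\theta\,d\phi\big]^2+\frac{\rho^2}{Q}dr^2+\frac{\rho^2}{P}d\theta^2+\frac{P}{\rho^2}\sin^2\theta\big[a\,dt-(r^2+a^2)d\phi\big]^2\Big\},$$ $\Omega=1-\alpha r\cos\theta>0$, $\rho=\sqrt{r^2+a^2\cos^2\theta}\neq0$, $P=1-2\alpha m\cos\theta+(\alpha^2(a^2+q^2)+\frac13\Lambda a^2)\cos^2\theta>0$, $0<\theta<\pi$, $Q$ as in the claim. Null tetrad (components in the order $t,r,\theta,\phi$, where $Q>0$): $l^\mu=\frac{-\Omega}{\sqrt2\rho}\big(\frac{r^2+a^2}{\sqrt Q},\sqrt Q,0,\frac{a}{\sqrt Q}\big)$, $n^\mu=\frac{-\Omega}{\sqrt2\rho}\big(\frac{r^2+a^2}{\sqrt Q},-\sqrt Q,0,\frac{a}{\sqrt Q}\big)$, $m^\mu=\frac{-\Omega}{\sqrt2\rho}\big(\frac{a\sin\theta}{\sqrt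 P},0,i\sqrt P,\frac{1}{\sqrt P\sin\theta}\big)$, and $\overline m^\mu$ the complex conjugate of $m^\mu$. Spin coefficients (up to an overall sign convention): $\varrho=m^\kappa\overline m^\lambda\nabla_\lambda l_\kappa$, $\mu=-\overline m^\kappa m^\lambda\nabla_\lambda n_\kappa$. "Vanish at $r_0$" means the limit as $r\to r_0$ (through $Q>0$) is $0$ for fixed $\theta$, with the conditions $\Omega=1-\alpha r\cos\theta>0$, $\rho\neq0$, $P>0$ and $0<\theta<\pi$ holding at $r=r_0$. Weyl scalar: $\Psi_2=C_{\kappa\nu\lambda\sigma}\overline m^\kappa n^\nu l^\lambda m^\sigma$, which equals $$\Psi_2=\frac{\Big(-m(1-ia\alpha)+\frac{q^2(1+\alpha r\cos\theta)}{r-ia\cos\theta}\Big)(1-\alpha r\cos\theta)^3}{(r+ia\cos\theta)^3}.$$ For (complex-valued) functions $f,h$ the norm of the wedge product is $\lVert df\wedge dh\rVert^2=\frac12\big((\nabla_\mu f\nabla^\mu f)(\nabla_\nu h\nabla^\nu h)-(\nabla_\mu f\nabla^\mu h)^2\big)$, with complex-bilinear contraction. $W$ is extended by continuity to $Q=0$. *)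

theory Defs
  imports "HOL-Analysis.Analysis"
begin

section \<open>Tensor calculus in a coordinate chart of a four-dimensional spacetime\<close>

text \<open>
  A point is its coordinate vector in \<^typ>\<open>real^4\<close>. A metric is the field of its component
  matrices \<open>g\<^sub>i\<^sub>j\<close>; fields are total functions, and are meaningful only where the metric is smooth
  and invertible. Complex vectors are contracted complex-bilinearly.
\<close>

type_synonym metric_field = "real^4 \<Rightarrow> real^4^4"

definition partial :: "4 \<Rightarrow> (real^4 \<Rightarrow> 'b::real_normed_vector) \<Rightarrow> real^4 \<Rightarrow> 'b" where
  "partial i f x = vector_derivative (\<lambda>s. f (x + s *\<^sub>R axis i 1)) (at 0)"

text \<open>\<open>christoffel g x k i j\<close> is \<open>\<Gamma>\<^sup>k\<^sub>i\<^sub>j\<close>.\<close>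

definition christoffel :: "metric_field \<Rightarrow> real^4 \<Rightarrow> 4 \<Rightarrow> 4 \<Rightarrow> 4 \<Rightarrow> real" where
  "christoffel g x k i j = (1/2) * (\<Sum>l\<in>UNIV. matrix_inv (g x) $ k $ l *
     (partial i (\<lambda>y. g y $ j $ l) x + partial j (\<lambda>y. g y $ i $ l) x - partial l (\<lambda>y. g y $ i $ j) x))"

definition lower_index :: "metric_field \<Rightarrow> (real^4 \<Rightarrow> complex^4) \<Rightarrow> real^4 \<Rightarrow> complex^4" where
  "lower_index g v x = (\<chi> k. \<Sum>j\<in>UNIV. complex_of_real (g x $ k $ j) * v x $ j)"

text \<open>\<open>cov_deriv g w x i k\<close> is \<open>\<nabla>\<^sub>i w\<^sub>k\<close> for a covector field \<open>w\<close>.\<close>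

definition cov_deriv :: "metric_field \<Rightarrow> (real^4 \<Rightarrow> complex^4) \<Rightarrow> real^4 \<Rightarrow> 4 \<Rightarrow> 4 \<Rightarrow> complex" where
  "cov_deriv g w x i k = partial i (\<lambda>y. w y $ k) x
     - (\<Sum>s\<in>UNIV. complex_of_real (christoffel g x s i k) * w x $ s)"

text \<open>
  \<open>riemann_up g x p b c d\<close> is \<open>R\<^sup>p\<^sub>b\<^sub>c\<^sub>d = \<partial>\<^sub>c \<Gamma>\<^sup>p\<^sub>d\<^sub>b - \<partial>\<^sub>d \<Gamma>\<^sup>p\<^sub>c\<^sub>b + \<Gamma>\<^sup>p\<^sub>c\<^sub>e \<Gamma>\<^sup>e\<^sub>d\<^sub>b - \<Gamma>\<^sup>p\<^sub>d\<^sub>e \<Gamma>\<^sup>e\<^sub>c\<^sub>b\<close>,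
  and \<open>R\<^sub>b\<^sub>d = R\<^sup>e\<^sub>b\<^sub>e\<^sub>d\<close>.
\<close>

definition riemann_up :: "metric_field \<Rightarrow> real^4 \<Rightarrow> 4 \<Rightarrow> 4 \<Rightarrow> 4 \<Rightarrow> 4 \<Rightarrow> real" where
  "riemann_up g x p b c d =
     partial c (\<lambda>y. christoffel g y p d b) x - partial d (\<lambda>y. christoffel g y p c b) x
     + (\<Sum>e\<in>UNIV. christoffel g x p c e * christoffel g x e d b
                  - christoffel g x p d e * christoffel g x e c b)"

definition riemann :: "metric_field \<Rightarrow> real^4 \<Rightarrow> 4 \<Rightarrow> 4 \<Rightarrow> 4 \<Rightarrow> 4 \<Rightarrow> real" where
  "riemann g x p b c d = (\<Sum>e\<in>UNIV. g x $ p $ e * riemann_up g x e b c d)"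

definition ricci :: "metric_field \<Rightarrow> real^4 \<Rightarrow> 4 \<Rightarrow> 4 \<Rightarrow> real" where
  "ricci g x b d = (\<Sum>e\<in>UNIV. riemann_up g x e b e d)"

definition scalar_curvature :: "metric_field \<Rightarrow> real^4 \<Rightarrow> real" where
  "scalar_curvature g x = (\<Sum>b\<in>UNIV. \<Sum>d\<in>UNIV. matrix_inv (g x) $ b $ d * ricci g x b d)"

text \<open>The coefficients \<open>1/2\<close> and \<open>1/6\<close> are those of dimension four.\<close>

definition weyl :: "metric_field \<Rightarrow> real^4 \<Rightarrow> 4 \<Rightarrow> 4 \<Rightarrow> 4 \<Rightarrow> 4 \<Rightarrow> real" where
  "weyl g x p b c d = riemann g x p b c d
     - (1/2) * (g x $ p $ c * ricci g x b d - g x $ p $ d * ricci g x b c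
                - g x $ b $ c * ricci g x p d + g x $ b $ d * ricci g x p c)
     + (1/6) * scalar_curvature g x * (g x $ p $ c * g x $ b $ d - g x $ p $ d * g x $ b $ c)"

definition grad_prod ::
  "metric_field \<Rightarrow> (real^4 \<Rightarrow> complex) \<Rightarrow> (real^4 \<Rightarrow> complex) \<Rightarrow> real^4 \<Rightarrow> complex" where
  "grad_prod g f h x = (\<Sum>i\<in>UNIV. \<Sum>j\<in>UNIV.
     complex_of_real (matrix_inv (g x) $ i $ j) * partial i f x * partial j h x)"

definition wedge_norm2 ::
  "metric_field \<Rightarrow> (real^4 \<Rightarrow> complex) \<Rightarrow> (real^4 \<Rightarrow> complex) \<Rightarrow> real^4 \<Rightarrow> complex" where
  "wedge_norm2 g f h x = (1/2) * (grad_prod g f f x * grad_prod g h h x - (grad_prod g f h x)\<^sup>2)"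


section \<open>The accelerating Kerr-Newman-(anti-)de Sitter metric\<close>

text \<open>
  The coordinates \<open>t, r, \<theta>, \<phi>\<close> are the components \<open>1, 2, 3, 4\<close> (and \<open>4 = 0\<close> in the index type).
  The parameters always come in the order \<open>a, m, q, \<Lambda>, \<alpha>\<close>.
\<close>

definition akn_Omega :: "real \<Rightarrow> real \<Rightarrow> real \<Rightarrow> real" where
  "akn_Omega \<alpha> r \<theta> = 1 - \<alpha> * r * cos \<theta>"

definition akn_rho :: "real \<Rightarrow> real \<Rightarrow> real \<Rightarrow> real" where
  "akn_rho a r \<theta> = sqrt (r\<^sup>2 + a\<^sup>2 * (cos \<theta>)\<^sup>2)"

definition akn_P :: "real \<Rightarrow> real \<Rightarrow> real \<Rightarrow> real \<Rightarrow> real \<Rightarrow> real \<Rightarrow> real" where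
  "akn_P a m q \<Lambda> \<alpha> \<theta> =
     1 - 2 * \<alpha> * m * cos \<theta> + (\<alpha>\<^sup>2 * (a\<^sup>2 + q\<^sup>2) + (1/3) * \<Lambda> * a\<^sup>2) * (cos \<theta>)\<^sup>2"

definition akn_Q :: "real \<Rightarrow> real \<Rightarrow> real \<Rightarrow> real \<Rightarrow> real \<Rightarrow> real \<Rightarrow> real" where
  "akn_Q a m q \<Lambda> \<alpha> r =
     (a\<^sup>2 + q\<^sup>2 - 2 * m * r + r\<^sup>2) * (1 - \<alpha>\<^sup>2 * r\<^sup>2) - (1/3) * \<Lambda> * (a\<^sup>2 + r\<^sup>2) * r\<^sup>2"

definition akn_metric :: "real \<Rightarrow> real \<Rightarrow> real \<Rightarrow> real \<Rightarrow> real \<Rightarrow> metric_field" where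
  "akn_metric a m q \<Lambda> \<alpha> x =
    (let r = x $ 2; \<theta> = x $ 3;
         Om = akn_Omega \<alpha> r \<theta>; \<rho> = akn_rho a r \<theta>;
         P = akn_P a m q \<Lambda> \<alpha> \<theta>; Q = akn_Q a m q \<Lambda> \<alpha> r;
         \<sigma> = (vector [1, 0, 0, - a * (sin \<theta>)\<^sup>2] :: real^4);
         dr = (vector [0, 1, 0, 0] :: real^4);
         d\<theta> = (vector [0, 0, 1, 0] :: real^4);
         \<tau> = (vector [a, 0, 0, - (r\<^sup>2 + a\<^sup>2)] :: real^4)
     in \<chi> i j. 1 / Om\<^sup>2 *
          (- (Q / \<rho>\<^sup>2) * \<sigma> $ i * \<sigma> $ j + \<rho>\<^sup>2 / Q * dr $ i * dr $ j
           + \<rho>\<^sup>2 / P * d\<theta> $ i * d\<theta> $ j + P / \<rho>\<^sup>2 * (sin \<theta>)\<^sup>2 * \<tau> $ i * \<tau> $ j))"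

definition akn_domain :: "real \<Rightarrow> real \<Rightarrow> real \<Rightarrow> real \<Rightarrow> real \<Rightarrow> (real^4) set" where
  "akn_domain a m q \<Lambda> \<alpha> = {x. akn_Omega \<alpha> (x $ 2) (x $ 3) > 0 \<and> akn_rho a (x $ 2) (x $ 3) \<noteq> 0
     \<and> akn_P a m q \<Lambda> \<alpha> (x $ 3) > 0 \<and> 0 < x $ 3 \<and> x $ 3 < pi}"

text \<open>The null tetrad, and all quantities built from it, are meaningful where also \<open>Q > 0\<close>.\<close>

definition akn_tetrad_domain :: "real \<Rightarrow> real \<Rightarrow> real \<Rightarrow> real \<Rightarrow> real \<Rightarrow> (real^4) set" where
  "akn_tetrad_domain a m q \<Lambda> \<alpha> = {x \<in> akn_domain a m q \<Lambda> \<alpha>. akn_Q a m q \<Lambda> \<alpha> (x $ 2) > 0}"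

definition tetrad_factor :: "real \<Rightarrow> real \<Rightarrow> real^4 \<Rightarrow> complex" where
  "tetrad_factor a \<alpha> x =
     complex_of_real (- akn_Omega \<alpha> (x $ 2) (x $ 3) / (sqrt 2 * akn_rho a (x $ 2) (x $ 3)))"

definition tetrad_l :: "real \<Rightarrow> real \<Rightarrow> real \<Rightarrow> real \<Rightarrow> real \<Rightarrow> real^4 \<Rightarrow> complex^4" where
  "tetrad_l a m q \<Lambda> \<alpha> x =
    (let r = x $ 2; Q = akn_Q a m q \<Lambda> \<alpha> r
     in tetrad_factor a \<alpha> x *s
          vector [complex_of_real ((r\<^sup>2 + a\<^sup>2) / sqrt Q), complex_of_real (sqrt Q), 0,
                  complex_of_real (a / sqrt Q)])"

definition tetrad_n :: "real \<Rightarrow> real \<Rightarrow> real \<Rightarrow> real \<Rightarrow> real \<Rightarrow> real^4 \<Rightarrow> complex^4" where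
  "tetrad_n a m q \<Lambda> \<alpha> x =
    (let r = x $ 2; Q = akn_Q a m q \<Lambda> \<alpha> r
     in tetrad_factor a \<alpha> x *s
          vector [complex_of_real ((r\<^sup>2 + a\<^sup>2) / sqrt Q), - complex_of_real (sqrt Q), 0,
                  complex_of_real (a / sqrt Q)])"

definition tetrad_m :: "real \<Rightarrow> real \<Rightarrow> real \<Rightarrow> real \<Rightarrow> real \<Rightarrow> real^4 \<Rightarrow> complex^4" where
  "tetrad_m a m q \<Lambda> \<alpha> x =
    (let \<theta> = x $ 3; P = akn_P a m q \<Lambda> \<alpha> \<theta>
     in tetrad_factor a \<alpha> x *s
          vector [complex_of_real (a * sin \<theta> / sqrt P), 0, \<i> * complex_of_real (sqrt P),
                  complex_of_real (1 / (sqrt P * sin \<theta>))])"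

definition tetrad_mbar :: "real \<Rightarrow> real \<Rightarrow> real \<Rightarrow> real \<Rightarrow> real \<Rightarrow> real^4 \<Rightarrow> complex^4" where
  "tetrad_mbar a m q \<Lambda> \<alpha> x = (\<chi> k. cnj (tetrad_m a m q \<Lambda> \<alpha> x $ k))"

definition spin_rho :: "real \<Rightarrow> real \<Rightarrow> real \<Rightarrow> real \<Rightarrow> real \<Rightarrow> real^4 \<Rightarrow> complex" where
  "spin_rho a m q \<Lambda> \<alpha> x =
    (let g = akn_metric a m q \<Lambda> \<alpha>
     in \<Sum>k\<in>UNIV. \<Sum>l\<in>UNIV. tetrad_m a m q \<Lambda> \<alpha> x $ k * tetrad_mbar a m q \<Lambda> \<alpha> x $ l *
          cov_deriv g (lower_index g (tetrad_l a m q \<Lambda> \<alpha>)) x l k)"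

definition spin_mu :: "real \<Rightarrow> real \<Rightarrow> real \<Rightarrow> real \<Rightarrow> real \<Rightarrow> real^4 \<Rightarrow> complex" where
  "spin_mu a m q \<Lambda> \<alpha> x =
    (let g = akn_metric a m q \<Lambda> \<alpha>
     in - (\<Sum>k\<in>UNIV. \<Sum>l\<in>UNIV. tetrad_mbar a m q \<Lambda> \<alpha> x $ k * tetrad_m a m q \<Lambda> \<alpha> x $ l *
          cov_deriv g (lower_index g (tetrad_n a m q \<Lambda> \<alpha>)) x l k))"

definition weyl_Psi2 :: "real \<Rightarrow> real \<Rightarrow> real \<Rightarrow> real \<Rightarrow> real \<Rightarrow> real^4 \<Rightarrow> complex" where
  "weyl_Psi2 a m q \<Lambda> \<alpha> x =
    (\<Sum>k\<in>UNIV. \<Sum>v\<in>UNIV. \<Sum>l\<in>UNIV. \<Sum>s\<in>UNIV.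
       complex_of_real (weyl (akn_metric a m q \<Lambda> \<alpha>) x k v l s) *
       tetrad_mbar a m q \<Lambda> \<alpha> x $ k * tetrad_n a m q \<Lambda> \<alpha> x $ v *
       tetrad_l a m q \<Lambda> \<alpha> x $ l * tetrad_m a m q \<Lambda> \<alpha> x $ s)"

definition page_shoom_W :: "real \<Rightarrow> real \<Rightarrow> real \<Rightarrow> real \<Rightarrow> real \<Rightarrow> real^4 \<Rightarrow> complex" where
  "page_shoom_W a m q \<Lambda> \<alpha> =
     wedge_norm2 (akn_metric a m q \<Lambda> \<alpha>) (weyl_Psi2 a m q \<Lambda> \<alpha>) (\<lambda>x. cnj (weyl_Psi2 a m q \<Lambda> \<alpha> x))"

end

theory Submission
  imports Defs
begin

text \<open>
  Since \<open>\<Psi>\<^sub>2\<close> depends on \<open>r\<close> and \<open>\<theta>\<close> only, \<open>W\<close> equals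
  \<open>1/2 g\<^sup>r\<^sup>r g\<^sup>\<theta>\<^sup>\<theta> J\<^sup>2\<close>, where \<open>J\<close> is the Jacobian of \<open>(\<Psi>\<^sub>2, cnj \<Psi>\<^sub>2)\<close>, and
  \<open>g\<^sup>r\<^sup>r = \<Omega>\<^sup>2 Q / \<rho>\<^sup>2\<close> vanishes with \<open>Q\<close>. So only the boundedness of \<open>J\<close> is at stake, that is, a
  smooth extension of \<open>\<Psi>\<^sub>2\<close> across the horizon. No closed formula for \<open>\<Psi>\<^sub>2\<close> is computed: in
  Eddington-Finkelstein coordinates the metric and its inverse are regular at \<open>Q = 0\<close>, hence so is
  the Weyl tensor, and \<open>\<Psi>\<^sub>2\<close> involves \<open>l\<close> and \<open>n\<close> only through \<open>l \<otimes> n\<close>, which is regular as well.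
  In \<open>\<varrho>\<close> and \<open>\<mu>\<close> the contraction with \<open>m, cnj m\<close> meets only \<open>g\<^sup>r\<^sup>r l\<^sub>r\<close> and \<open>\<partial>\<^sub>\<theta> l\<^sub>A\<close>
  (\<open>A = t, \<phi>\<close>), and both are \<open>sqrt Q\<close> times a regular function. Passing from \<open>l\<close> to \<open>n\<close> changes the
  sign of the \<open>r\<close>-component only, which the conjugation and the sign in \<open>\<mu>\<close> undo.
\<close>

section \<open>Smooth functions of the radius and the polar angle\<close>

text \<open>
  An inductive class rather than \<open>C\<^sup>\<infinity>\<close>: being closed under partial derivatives, it allows any number
  of differentiations without a separate hypothesis for each order. The sets \<open>S\<close> below differ in whether
  \<open>1 / Q\<close> belongs to the class, i.e. in whether the horizon is included.
\<close>

inductive rt_smooth :: "(real^4) set \<Rightarrow> (real^4 \<Rightarrow> real) \<Rightarrow> bool" for S where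
  const: "rt_smooth S (\<lambda>x. c)"
| coord: "rt_smooth S (\<lambda>x. x $ 2)"
| sine: "rt_smooth S (\<lambda>x. sin (x $ 3))"
| cosine: "rt_smooth S (\<lambda>x. cos (x $ 3))"
| add: "rt_smooth S f \<Longrightarrow> rt_smooth S h \<Longrightarrow> rt_smooth S (\<lambda>x. f x + h x)"
| mult: "rt_smooth S f \<Longrightarrow> rt_smooth S h \<Longrightarrow> rt_smooth S (\<lambda>x. f x * h x)"
| inverse: "rt_smooth S f \<Longrightarrow> (\<And>x. x \<in> S \<Longrightarrow> f x \<noteq> 0) \<Longrightarrow> rt_smooth S (\<lambda>x. inverse (f x))"
| sqrt: "rt_smooth S f \<Longrightarrow> (\<And>x. x \<in> S \<Longrightarrow> f x > 0) \<Longrightarrow> rt_smooth S (\<lambda>x. sqrt (f x))"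
| cong: "rt_smooth S f \<Longrightarrow> (\<And>x. x \<in> S \<Longrightarrow> h x = f x) \<Longrightarrow> rt_smooth S h"

lemma rt_smooth_uminus: "rt_smooth S f \<Longrightarrow> rt_smooth S (\<lambda>x. - f x)"
  using rt_smooth.mult[OF rt_smooth.const[of S "-1"], of f] by simp

lemma rt_smooth_diff:
  assumes "rt_smooth S f" "rt_smooth S h" shows "rt_smooth S (\<lambda>x. f x - h x)"
  using rt_smooth.add[OF assms(1) rt_smooth_uminus[OF assms(2)]] by simp

lemma rt_smooth_power: "rt_smooth S f \<Longrightarrow> rt_smooth S (\<lambda>x. f x ^ n)"
  by (induction n) (auto intro: rt_smooth.intros(1,6))

lemma rt_smooth_divide:
  assumes "rt_smooth S f" "rt_smooth S h" "\<And>x. x \<in> S \<Longrightarrow> h x \<noteq> 0"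
  shows "rt_smooth S (\<lambda>x. f x / h x)"
  using rt_smooth.mult[OF assms(1) rt_smooth.inverse[OF assms(2,3)]] by (simp add: divide_inverse)

lemma rt_smooth_sum: "(\<And>i. i \<in> I \<Longrightarrow> rt_smooth S (f i)) \<Longrightarrow> rt_smooth S (\<lambda>x. \<Sum>i\<in>I. f i x)"
proof (induction I rule: infinite_finite_induct)
  case (insert i I)
  then show ?case by (simp add: rt_smooth.add)
qed (simp_all add: rt_smooth.const)

text \<open>A smaller set only weakens the side conditions of \<open>inverse\<close>,
  \<open>sqrt\<close> and \<open>cong\<close>. Functions shown regular across the horizon thus
  become available where the tetrad is defined.\<close>

lemma rt_smooth_mono: "rt_smooth U f \<Longrightarrow> S \<subseteq> U \<Longrightarrow> rt_smooth S f"
proof (induction rule: rt_smooth.induct)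
  case (cong f h)
  then show ?case by (meson rt_smooth.cong subsetD)
qed (auto intro: rt_smooth.intros(1-8))

lemmas rt_smooth_intros = rt_smooth.intros(1-8) rt_smooth_uminus rt_smooth_diff rt_smooth_power
  rt_smooth_divide rt_smooth_sum

lemma vec_nth_has_derivative: "((\<lambda>x. x $ i) has_derivative (\<lambda>h. h $ i)) F"
  by (rule bounded_linear_imp_has_derivative[OF bounded_linear_vec_nth])

text \<open>Induction over the class: the usual differentiation rules express both coefficients by
  functions of the class again. Openness of \<open>S\<close> serves the \<open>cong\<close> case,
  where agreement on \<open>S\<close> must determine the derivative.\<close>

lemma rt_smooth_has_derivative:
  assumes "rt_smooth S f" "open S"
  shows "\<exists>f2 f3. rt_smooth S f2 \<and> rt_smooth S f3
    \<and> (\<forall>x\<in>S. (f has_derivative (\<lambda>h. f2 x * h $ 2 + f3 x * h $ 3)) (at x))"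
  using assms
proof (induction rule: rt_smooth.induct)
  case (const c)
  show ?case
    by (rule exI[of _ "\<lambda>_. 0"], rule exI[of _ "\<lambda>_. 0"]) (auto intro: rt_smooth_intros)
next
  case coord
  show ?case
    by (rule exI[of _ "\<lambda>_. 1"], rule exI[of _ "\<lambda>_. 0"])
      (auto intro!: rt_smooth_intros vec_nth_has_derivative)
next
  case sine
  have "((\<lambda>x. sin (x $ 3)) has_derivative (\<lambda>h. 0 * h $ 2 + cos (x $ 3) * h $ 3)) (at x)" for x :: "real^4"
    by (auto intro!: derivative_eq_intros vec_nth_has_derivative)
  then show ?case
    by (intro exI[of _ "\<lambda>_. 0"] exI[of _ "\<lambda>x. cos (x $ 3)"]) (auto intro: rt_smooth_intros)
next
  case cosine
  have "((\<lambda>x. cos (x $ 3)) has_derivative (\<lambda>h. 0 * h $ 2 + - sin (x $ 3) * h $ 3)) (at x)" for x :: "real^4"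
    by (auto intro!: derivative_eq_intros vec_nth_has_derivative)
  then show ?case
    by (intro exI[of _ "\<lambda>_. 0"] exI[of _ "\<lambda>x. - sin (x $ 3)"]) (auto intro: rt_smooth_intros)
next
  case (add f h)
  then obtain f2 f3 h2 h3 where sm: "rt_smooth S f2" "rt_smooth S f3" "rt_smooth S h2" "rt_smooth S h3"
    and f: "\<And>x. x\<in>S \<Longrightarrow> (f has_derivative (\<lambda>v. f2 x * v $ 2 + f3 x * v $ 3)) (at x)"
    and h: "\<And>x. x\<in>S \<Longrightarrow> (h has_derivative (\<lambda>v. h2 x * v $ 2 + h3 x * v $ 3)) (at x)" by blast
  have "((\<lambda>x. f x + h x) has_derivative (\<lambda>v. (f2 x + h2 x) * v $ 2 + (f3 x + h3 x) * v $ 3)) (at x)"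
    if "x \<in> S" for x
    using has_derivative_add[OF f[OF that] h[OF that]] by (simp add: algebra_simps)
  then show ?case
    by (intro exI[of _ "\<lambda>x. f2 x + h2 x"] exI[of _ "\<lambda>x. f3 x + h3 x"]) (auto intro: sm rt_smooth_intros)
next
  case (mult f h)
  then obtain f2 f3 h2 h3 where sm: "rt_smooth S f2" "rt_smooth S f3" "rt_smooth S h2" "rt_smooth S h3"
    and f: "\<And>x. x\<in>S \<Longrightarrow> (f has_derivative (\<lambda>v. f2 x * v $ 2 + f3 x * v $ 3)) (at x)"
    and h: "\<And>x. x\<in>S \<Longrightarrow> (h has_derivative (\<lambda>v. h2 x * v $ 2 + h3 x * v $ 3)) (at x)" by blast
  have "((\<lambda>x. f x * h x) has_derivative
      (\<lambda>v. (f2 x * h x + f x * h2 x) * v $ 2 + (f3 x * h x + f x * h3 x) * v $ 3)) (at x)"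
    if "x \<in> S" for x
    using has_derivative_mult[OF f[OF that] h[OF that]] by (simp add: algebra_simps)
  then show ?case
    by (intro exI[of _ "\<lambda>x. f2 x * h x + f x * h2 x"] exI[of _ "\<lambda>x. f3 x * h x + f x * h3 x"])
      (auto intro!: sm rt_smooth_intros mult.hyps)
next
  case (inverse f)
  then obtain f2 f3 where sm: "rt_smooth S f2" "rt_smooth S f3"
    and f: "\<And>x. x\<in>S \<Longrightarrow> (f has_derivative (\<lambda>v. f2 x * v $ 2 + f3 x * v $ 3)) (at x)" by blast
  let ?d = "\<lambda>x. - (inverse (f x) * inverse (f x))"
  have "((\<lambda>x. inverse (f x)) has_derivative
      (\<lambda>v. (?d x * f2 x) * v $ 2 + (?d x * f3 x) * v $ 3)) (at x)"
    if "x \<in> S" for x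
    using Deriv.has_derivative_inverse[OF inverse(2)[OF that] f[OF that]] by (simp add: algebra_simps)
  moreover have "rt_smooth S ?d"
    by (intro rt_smooth_intros inverse)
  then have "rt_smooth S (\<lambda>x. ?d x * f2 x)" "rt_smooth S (\<lambda>x. ?d x * f3 x)"
    by - (assumption | rule rt_smooth.mult sm)+
  ultimately show ?case
    by (intro exI[of _ "\<lambda>x. ?d x * f2 x"] exI[of _ "\<lambda>x. ?d x * f3 x"] conjI ballI)
next
  case (sqrt f)
  then obtain f2 f3 where sm: "rt_smooth S f2" "rt_smooth S f3"
    and f: "\<And>x. x\<in>S \<Longrightarrow> (f has_derivative (\<lambda>v. f2 x * v $ 2 + f3 x * v $ 3)) (at x)" by blast
  let ?d = "\<lambda>x. inverse (2 * sqrt (f x))"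
  have "((\<lambda>x. sqrt (f x)) has_derivative
      (\<lambda>v. (?d x * f2 x) * v $ 2 + (?d x * f3 x) * v $ 3)) (at x)"
    if "x \<in> S" for x
    using has_derivative_real_sqrt[OF sqrt(2)[OF that] f[OF that]] by (simp add: field_simps add_divide_distrib)
  moreover have "rt_smooth S ?d"
  proof (rule rt_smooth.inverse)
    show "rt_smooth S (\<lambda>x. 2 * sqrt (f x))"
      using sqrt(1,2) by (rule rt_smooth.mult[OF rt_smooth.const rt_smooth.sqrt])
    show "2 * sqrt (f x) \<noteq> 0" if "x \<in> S" for x
      using sqrt(2)[OF that] by simp
  qed
  then have "rt_smooth S (\<lambda>x. ?d x * f2 x)" "rt_smooth S (\<lambda>x. ?d x * f3 x)"
    by - (assumption | rule rt_smooth.mult sm)+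
  ultimately show ?case
    by (intro exI[of _ "\<lambda>x. ?d x * f2 x"] exI[of _ "\<lambda>x. ?d x * f3 x"] conjI ballI)
next
  case (cong f h)
  then obtain f2 f3 where sm: "rt_smooth S f2" "rt_smooth S f3"
    and f: "\<And>x. x\<in>S \<Longrightarrow> (f has_derivative (\<lambda>v. f2 x * v $ 2 + f3 x * v $ 3)) (at x)" by blast
  have "(h has_derivative (\<lambda>v. f2 x * v $ 2 + f3 x * v $ 3)) (at x)" if "x \<in> S" for x
    by (rule has_derivative_transform_within_open[OF f[OF that] \<open>open S\<close> that]) (simp add: cong(2))
  then show ?case
    using sm by blast
qed

section \<open>Coordinate derivatives of functions in the class\<close>

lemma partial_eq_derivative:
  assumes "(f has_derivative D) (at x)"
  shows "partial i f x = D (axis i 1)"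
proof -
  have "((\<lambda>s. x + s *\<^sub>R axis i 1) has_derivative (\<lambda>s. s *\<^sub>R axis i 1)) (at (0::real))"
    by (auto intro!: derivative_eq_intros)
  then have "((\<lambda>s. f (x + s *\<^sub>R axis i 1)) has_derivative (\<lambda>s. D (s *\<^sub>R axis i 1))) (at 0)"
    using diff_chain_at[of "\<lambda>s. x + s *\<^sub>R axis i 1" _ 0 f D] assms by (simp add: o_def)
  then have "((\<lambda>s. f (x + s *\<^sub>R axis i 1)) has_vector_derivative D (axis i 1)) (at 0)"
    unfolding has_vector_derivative_def
    by (simp add: linear_cmul[OF has_derivative_linear[OF assms]])
  then show ?thesis
    by (simp add: partial_def vector_derivative_at)
qed

lemma partial_cong:
  assumes "open S" "x \<in> S" "\<And>y. y \<in> S \<Longrightarrow> f y = h y" "(h has_derivative D) (at x)"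
  shows "partial i f x = partial i h x"
proof -
  have "(f has_derivative D) (at x)"
    by (rule has_derivative_transform_within_open[OF assms(4,1,2)]) (simp add: assms(3))
  then show ?thesis
    using partial_eq_derivative assms(4) by (auto simp: partial_eq_derivative)
qed

lemma axis_4_nth [simp]:
  "(axis 2 1 :: real^4) $ 2 = 1" "(axis 3 1 :: real^4) $ 3 = 1"
  "(axis 3 1 :: real^4) $ 2 = 0" "(axis 2 1 :: real^4) $ 3 = 0"
  "(axis 1 1 :: real^4) $ 2 = 0" "(axis 1 1 :: real^4) $ 3 = 0"
  "(axis 4 1 :: real^4) $ 2 = 0" "(axis 4 1 :: real^4) $ 3 = 0"
  by (simp_all add: axis_def)

context
  fixes S :: "(real^4) set"
  assumes op: "open S"
begin

lemma rt_smooth_derivative: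
  assumes "rt_smooth S f" "x \<in> S"
  shows "(f has_derivative (\<lambda>h. partial 2 f x * h $ 2 + partial 3 f x * h $ 3)) (at x)"
proof -
  obtain f2 f3 where f: "(f has_derivative (\<lambda>h. f2 x * h $ 2 + f3 x * h $ 3)) (at x)"
    using rt_smooth_has_derivative[OF assms(1) op] assms(2) by blast
  show ?thesis
    using f partial_eq_derivative[OF f, of 2] partial_eq_derivative[OF f, of 3] by simp
qed

lemma rt_smooth_partial_1_4 [simp]:
  assumes "rt_smooth S f" "x \<in> S"
  shows "partial 1 f x = 0" "partial 4 f x = 0"
  using partial_eq_derivative[OF rt_smooth_derivative[OF assms], of 1]
    partial_eq_derivative[OF rt_smooth_derivative[OF assms], of 4] by simp_all

lemma rt_smooth_partial:
  assumes "rt_smooth S f"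
  shows "rt_smooth S (partial i f)"
proof -
  obtain f2 f3 where sm: "rt_smooth S f2" "rt_smooth S f3"
    and f: "\<And>x. x\<in>S \<Longrightarrow> (f has_derivative (\<lambda>h. f2 x * h $ 2 + f3 x * h $ 3)) (at x)"
    using rt_smooth_has_derivative[OF assms op] by blast
  have "rt_smooth S (\<lambda>x. f2 x * axis i 1 $ 2 + f3 x * axis i 1 $ 3)"
    by (intro rt_smooth_intros sm)
  then show ?thesis
    by (rule rt_smooth.cong) (use partial_eq_derivative[OF f] in simp)
qed

lemma rt_smooth_isCont: "rt_smooth S f \<Longrightarrow> x \<in> S \<Longrightarrow> isCont f x"
  using has_derivative_continuous[OF rt_smooth_derivative] by auto

lemma partial_rt_add:
  assumes "rt_smooth S f" "rt_smooth S h" "x \<in> S"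
  shows "partial i (\<lambda>y. f y + h y) x = partial i f x + partial i h x"
  using partial_eq_derivative[OF has_derivative_add[OF rt_smooth_derivative[OF assms(1,3)]
        rt_smooth_derivative[OF assms(2,3)]], of i]
    partial_eq_derivative[OF rt_smooth_derivative[OF assms(1,3)], of i]
    partial_eq_derivative[OF rt_smooth_derivative[OF assms(2,3)], of i] by simp

lemma partial_rt_mult:
  assumes "rt_smooth S f" "rt_smooth S h" "x \<in> S"
  shows "partial i (\<lambda>y. f y * h y) x = partial i f x * h x + f x * partial i h x"
  using partial_eq_derivative[OF has_derivative_mult[OF rt_smooth_derivative[OF assms(1,3)]
        rt_smooth_derivative[OF assms(2,3)]], of i]
    partial_eq_derivative[OF rt_smooth_derivative[OF assms(1,3)], of i]
    partial_eq_derivative[OF rt_smooth_derivative[OF assms(2,3)], of i] by simp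

lemma partial_rt_sum:
  assumes "\<And>j. j \<in> J \<Longrightarrow> rt_smooth S (f j)" "x \<in> S"
  shows "partial i (\<lambda>y. \<Sum>j\<in>J. f j y) x = (\<Sum>j\<in>J. partial i (f j) x)"
  using assms(1)
proof (induction J rule: infinite_finite_induct)
  case (insert j J)
  then show ?case using assms(2) by (simp add: partial_rt_add rt_smooth_sum)
qed (simp_all add: partial_def)

end

text \<open>The class is real-valued, so complex fields are differentiated by real and imaginary
  part. Agreement is asked on \<open>S\<close> only, which allows a field to be replaced by its
  extension.\<close>

lemma partial_complex:
  assumes "open S" "rt_smooth S A" "rt_smooth S C" "x \<in> S" "\<And>y. y \<in> S \<Longrightarrow> f y = Complex (A y) (C y)"
  shows "partial i f x = Complex (partial i A x) (partial i C x)"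
proof -
  let ?D = "\<lambda>f h. partial 2 f x * h $ 2 + partial 3 f x * h $ 3"
  have "((\<lambda>y. of_real (A y) + \<i> * of_real (C y)) has_derivative
      (\<lambda>h. of_real (?D A h) + \<i> * of_real (?D C h))) (at x)"
    by (intro has_derivative_add has_derivative_mult_right has_derivative_of_real
        rt_smooth_derivative[OF assms(1)] assms)
  then have D: "(f has_derivative (\<lambda>h. of_real (?D A h) + \<i> * of_real (?D C h))) (at x)"
    by (rule has_derivative_transform_within_open[OF _ assms(1,4)]) (simp add: assms(5) complex_eq_iff)
  show ?thesis
    using partial_eq_derivative[OF D, of i]
      partial_eq_derivative[OF rt_smooth_derivative[OF assms(1,2,4)], of i]
      partial_eq_derivative[OF rt_smooth_derivative[OF assms(1,3,4)], of i]
    by (simp add: complex_eq_iff)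
qed

definition complex_rt_smooth :: "(real^4) set \<Rightarrow> (real^4 \<Rightarrow> complex) \<Rightarrow> bool" where
  "complex_rt_smooth S f \<longleftrightarrow> rt_smooth S (\<lambda>x. Re (f x)) \<and> rt_smooth S (\<lambda>x. Im (f x))"

lemma complex_rt_smooth_of_real: "rt_smooth S f \<Longrightarrow> complex_rt_smooth S (\<lambda>x. of_real (f x))"
  by (simp add: complex_rt_smooth_def rt_smooth.const)

lemma complex_rt_smooth_mult:
  "complex_rt_smooth S f \<Longrightarrow> complex_rt_smooth S h \<Longrightarrow> complex_rt_smooth S (\<lambda>x. f x * h x)"
  by (simp add: complex_rt_smooth_def rt_smooth_intros)

lemma complex_rt_smooth_sum:
  "(\<And>i. i \<in> I \<Longrightarrow> complex_rt_smooth S (f i)) \<Longrightarrow> complex_rt_smooth S (\<lambda>x. \<Sum>i\<in>I. f i x)"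
  by (simp add: complex_rt_smooth_def rt_smooth_sum)

section \<open>Curvature as a matrix-valued two-form\<close>

lemma vector_4_nth [simp]:
  "(vector [a, b, c, d] :: 'a::zero^4) $ 1 = a" "(vector [a, b, c, d] :: 'a::zero^4) $ 2 = b"
  "(vector [a, b, c, d] :: 'a::zero^4) $ 3 = c" "(vector [a, b, c, d] :: 'a::zero^4) $ 4 = d"
  by (simp_all add: vector_def)

lemma vector_4_eq_iff: "(v :: 'a^4) = v' \<longleftrightarrow> v$1 = v'$1 \<and> v$2 = v'$2 \<and> v$3 = v'$3 \<and> v$4 = v'$4"
  by (simp add: vec_eq_iff forall_4)

text \<open>\<open>matrix_inv\<close> is a choice among two-sided inverses; for square matrices a
  one-sided inverse is two-sided, hence unique.\<close>

lemma matrix_inv_eqI: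
  fixes A B :: "real^'n^'n"
  assumes "A ** B = mat 1"
  shows "matrix_inv A = B"
proof -
  have "B ** A = mat 1"
    using assms by (simp add: matrix_left_right_inverse)
  then have "\<exists>A'. A ** A' = mat 1 \<and> A' ** A = mat 1"
    using assms by blast
  then have "A ** matrix_inv A = mat 1 \<and> matrix_inv A ** A = mat 1"
    unfolding matrix_inv_def by (rule someI_ex)
  then show ?thesis
    by (metis assms matrix_mul_assoc matrix_mul_lid matrix_mul_rid)
qed

lemma matrix_mult_distribs:
  fixes A B C :: "real^4^4"
  shows "A ** (B + C) = A ** B + A ** C" "(B + C) ** A = B ** A + C ** A"
    "A ** (B - C) = A ** B - A ** C" "(B - C) ** A = B ** A - C ** A"
    "A ** (k *\<^sub>R B) = k *\<^sub>R (A ** B)" "(k *\<^sub>R B) ** A = k *\<^sub>R (B ** A)"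
    "A ** (- B) = - (A ** B)" "(- B) ** A = - (B ** A)"
  by (simp_all add: vec_eq_iff matrix_matrix_mult_def sum.distrib sum_subtractf sum_distrib_left
      sum_negf algebra_simps)

definition rt_matrix :: "(real^4) set \<Rightarrow> (real^4 \<Rightarrow> real^4^4) \<Rightarrow> bool" where
  "rt_matrix S M \<longleftrightarrow> (\<forall>i j. rt_smooth S (\<lambda>x. M x $ i $ j))"

definition partial_matrix :: "4 \<Rightarrow> (real^4 \<Rightarrow> real^4^4) \<Rightarrow> real^4 \<Rightarrow> real^4^4" where
  "partial_matrix i M x = (\<chi> a b. partial i (\<lambda>y. M y $ a $ b) x)"

text \<open>The connection one-form: for each direction \<open>i\<close> an endomorphism, so that
  index sums become matrix products. The lowered version below consists of the Christoffel symbols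
  of the first kind.\<close>

definition christoffel_matrix :: "metric_field \<Rightarrow> real^4 \<Rightarrow> 4 \<Rightarrow> real^4^4" where
  "christoffel_matrix g x i = (\<chi> k j. christoffel g x k i j)"

definition christoffel_lowered :: "metric_field \<Rightarrow> real^4 \<Rightarrow> 4 \<Rightarrow> real^4^4" where
  "christoffel_lowered g x i = (\<chi> l j. (1/2) * (partial_matrix i g x $ j $ l
     + partial_matrix j g x $ i $ l - partial_matrix l g x $ i $ j))"

definition curvature_matrix :: "metric_field \<Rightarrow> real^4 \<Rightarrow> 4 \<Rightarrow> 4 \<Rightarrow> real^4^4" where
  "curvature_matrix g x c d = (\<chi> p b. riemann_up g x p b c d)"

lemma christoffel_matrix_eq:
  "christoffel_matrix g x i = matrix_inv (g x) ** christoffel_lowered g x i"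
  by (simp add: vec_eq_iff christoffel_matrix_def christoffel_lowered_def christoffel_def
      partial_matrix_def matrix_matrix_mult_def sum_distrib_left ac_simps)

text \<open>Cartan's structure equation: with \<open>A\<close> the connection one-form, curvature is
  dA plus the commutator of \<open>A\<close> with itself.\<close>

lemma curvature_matrix_eq:
  "curvature_matrix g x c d =
     partial_matrix c (\<lambda>y. christoffel_matrix g y d) x - partial_matrix d (\<lambda>y. christoffel_matrix g y c) x
     + (christoffel_matrix g x c ** christoffel_matrix g x d
        - christoffel_matrix g x d ** christoffel_matrix g x c)"
  by (simp add: vec_eq_iff curvature_matrix_def christoffel_matrix_def riemann_up_def
      partial_matrix_def matrix_matrix_mult_def sum_subtractf)

lemma rt_matrix_cong: "rt_matrix S N \<Longrightarrow> (\<And>y. y \<in> S \<Longrightarrow> M y = N y) \<Longrightarrow> rt_matrix S M"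
  unfolding rt_matrix_def by (metis (no_types, lifting) rt_smooth.cong)

lemma rt_matrix_mult: "rt_matrix S M \<Longrightarrow> rt_matrix S N \<Longrightarrow> rt_matrix S (\<lambda>x. M x ** N x)"
  unfolding rt_matrix_def matrix_matrix_mult_def by (simp add: rt_smooth_sum rt_smooth.mult)

lemma rt_matrix_add: "rt_matrix S M \<Longrightarrow> rt_matrix S N \<Longrightarrow> rt_matrix S (\<lambda>x. M x + N x)"
  unfolding rt_matrix_def by (simp add: rt_smooth.add)

lemma rt_matrix_diff: "rt_matrix S M \<Longrightarrow> rt_matrix S N \<Longrightarrow> rt_matrix S (\<lambda>x. M x - N x)"
  unfolding rt_matrix_def by (simp add: rt_smooth_diff)

lemma rt_matrix_scaleR: "rt_smooth S f \<Longrightarrow> rt_matrix S N \<Longrightarrow> rt_matrix S (\<lambda>x. f x *\<^sub>R N x)"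
  unfolding rt_matrix_def by (simp add: rt_smooth.mult)

lemma rt_matrix_transpose: "rt_matrix S M \<Longrightarrow> rt_matrix S (\<lambda>x. transpose (M x))"
  unfolding rt_matrix_def transpose_def by simp

lemma rt_matrix_const: "rt_matrix S (\<lambda>x. A)"
  unfolding rt_matrix_def by (simp add: rt_smooth.const)

lemma partial_matrix_transpose:
  "partial_matrix i (\<lambda>y. transpose (M y)) x = transpose (partial_matrix i M x)"
  by (simp add: partial_matrix_def transpose_def vec_eq_iff)

context
  fixes S :: "(real^4) set"
  assumes op: "open S"
begin

lemma partial_rt_cong:
  assumes "rt_smooth S h" "x \<in> S" "\<And>y. y \<in> S \<Longrightarrow> f y = h y"
  shows "partial i f x = partial i h x"
  using partial_cong[OF op assms(2,3) rt_smooth_derivative[OF op assms(1,2)]] .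

lemma partial_matrix_cong:
  assumes "rt_matrix S N" "x \<in> S" "\<And>y. y \<in> S \<Longrightarrow> M y = N y"
  shows "partial_matrix i M x = partial_matrix i N x"
  using assms partial_rt_cong unfolding partial_matrix_def rt_matrix_def
  by (simp add: vec_eq_iff)

lemma rt_matrix_partial: "rt_matrix S M \<Longrightarrow> rt_matrix S (partial_matrix i M)"
  unfolding rt_matrix_def partial_matrix_def by (simp add: rt_smooth_partial[OF op])

lemma partial_matrix_1_4 [simp]:
  assumes "rt_matrix S M" "x \<in> S"
  shows "partial_matrix 1 M x = 0" "partial_matrix 4 M x = 0"
  using assms unfolding rt_matrix_def partial_matrix_def
  by (simp_all add: vec_eq_iff rt_smooth_partial_1_4[OF op])

lemma partial_matrix_mult:
  assumes "rt_matrix S M" "rt_matrix S N" "x \<in> S"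
  shows "partial_matrix i (\<lambda>y. M y ** N y) x
    = partial_matrix i M x ** N x + M x ** partial_matrix i N x"
  using assms unfolding rt_matrix_def partial_matrix_def
  by (simp add: vec_eq_iff matrix_matrix_mult_def partial_rt_sum[OF op] rt_smooth.mult
      partial_rt_mult[OF op] sum.distrib)

lemma partial_matrix_add:
  assumes "rt_matrix S M" "rt_matrix S N" "x \<in> S"
  shows "partial_matrix i (\<lambda>y. M y + N y) x = partial_matrix i M x + partial_matrix i N x"
  using assms unfolding rt_matrix_def partial_matrix_def
  by (simp add: vec_eq_iff partial_rt_add[OF op])

lemma partial_matrix_scaleR:
  assumes "rt_smooth S f" "rt_matrix S N" "x \<in> S"
  shows "partial_matrix i (\<lambda>y. f y *\<^sub>R N y) x = partial i f x *\<^sub>R N x + f x *\<^sub>R partial_matrix i N x"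
  using assms unfolding rt_matrix_def partial_matrix_def
  by (simp add: vec_eq_iff partial_rt_mult[OF op])

lemma rt_matrix_christoffel:
  assumes "rt_matrix S g" "rt_matrix S (\<lambda>x. matrix_inv (g x))"
  shows "rt_matrix S (\<lambda>x. christoffel_matrix g x i)"
proof -
  have "rt_matrix S (\<lambda>x. christoffel_lowered g x i)"
    using rt_matrix_partial[OF assms(1)] unfolding rt_matrix_def christoffel_lowered_def
    by (simp add: rt_smooth_intros(1,5,6,9-))
  then show ?thesis
    unfolding christoffel_matrix_eq by (rule rt_matrix_mult[OF assms(2)])
qed

end

lemma symmetric_matrix_nth:
  assumes "transpose M = M" shows "M $ i $ j = M $ j $ i"
proof -
  have "M $ i $ j = transpose M $ j $ i"
    by (simp add: transpose_def)
  with assms show ?thesis by simp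
qed

lemma transpose_0 [simp]: "transpose (0 :: real^'n^'m) = 0"
  by (simp add: transpose_def vec_eq_iff)

text \<open>
  \<open>shear u v\<close> is the Jacobian matrix of a change of coordinates \<open>t = t' + F r\<close>, \<open>\<phi> = \<phi>' + G r\<close> with
  \<open>F' = u\<close> and \<open>G' = v\<close>. As no field depends on \<open>t\<close> or \<open>\<phi>\<close>, the transformed metric is obtained pointwise
  by congruence with this matrix, and \<open>F\<close>, \<open>G\<close> themselves are never needed.
\<close>

definition shear :: "real \<Rightarrow> real \<Rightarrow> real^4^4" where
  "shear u v = vector [vector [1, u, 0, 0], vector [0, 1, 0, 0], vector [0, 0, 1, 0], vector [0, v, 0, 1]]"

text \<open>The nilpotent part of a shear: \<open>shear u v\<close> is
  \<open>mat 1 + shear_part u v\<close>, so derivatives of shears have this shape.\<close>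

definition shear_part :: "real \<Rightarrow> real \<Rightarrow> real^4^4" where
  "shear_part u v = vector [vector [0, u, 0, 0], 0, 0, vector [0, v, 0, 0]]"

lemma matrix_4_eq_iff:
  fixes A B :: "real^4^4"
  shows "A = B \<longleftrightarrow> A$1$1 = B$1$1 \<and> A$1$2 = B$1$2 \<and> A$1$3 = B$1$3 \<and> A$1$4 = B$1$4
    \<and> A$2$1 = B$2$1 \<and> A$2$2 = B$2$2 \<and> A$2$3 = B$2$3 \<and> A$2$4 = B$2$4
    \<and> A$3$1 = B$3$1 \<and> A$3$2 = B$3$2 \<and> A$3$3 = B$3$3 \<and> A$3$4 = B$3$4
    \<and> A$4$1 = B$4$1 \<and> A$4$2 = B$4$2 \<and> A$4$3 = B$4$3 \<and> A$4$4 = B$4$4"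
  by (simp add: vec_eq_iff forall_4)

lemma mat_1_nth:
  "(mat 1 :: real^4^4)$i$j = (if i = j then 1 else 0)"
  by (simp add: mat_def)

lemma matrix_4_mult_nth:
  "((A :: real^4^4) ** B)$i$j = A$i$1 * B$1$j + A$i$2 * B$2$j + A$i$3 * B$3$j + A$i$4 * B$4$j"
  by (simp add: matrix_matrix_mult_def sum_4)

text \<open>A \<open>shear_part\<close> maps the r-direction into the span of the t- and
  phi-directions and kills all others. Shears fix that span and move the r-direction only by
  elements of it, so they are absorbed on either side.\<close>

lemma shear_mult:
  "shear u v ** shear u' v' = shear (u + u') (v + v')"
  "shear u v ** shear_part u' v' = shear_part u' v'"
  "shear_part u v ** shear u' v' = shear_part u v"
  "shear_part u v ** shear_part u' v' = 0"
  "shear 0 0 = mat 1"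
  by (simp_all add: matrix_4_eq_iff matrix_4_mult_nth shear_def shear_part_def mat_1_nth)

section \<open>Contractions of the Weyl tensor\<close>

definition bilin :: "real^4^4 \<Rightarrow> complex^4 \<Rightarrow> complex^4 \<Rightarrow> complex" where
  "bilin A X Y = (\<Sum>i\<in>UNIV. \<Sum>j\<in>UNIV. of_real (A $ i $ j) * X $ i * Y $ j)"

definition complex_mult_vec :: "real^4^4 \<Rightarrow> complex^4 \<Rightarrow> complex^4" where
  "complex_mult_vec A X = (\<chi> i. \<Sum>j\<in>UNIV. of_real (A $ i $ j) * X $ j)"

definition weyl_contract :: "metric_field \<Rightarrow> real^4 \<Rightarrow> complex^4 \<Rightarrow> complex^4 \<Rightarrow> complex^4 \<Rightarrow> complex^4 \<Rightarrow> complex" where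
  "weyl_contract g x X Y Z V = (\<Sum>k\<in>UNIV. \<Sum>v\<in>UNIV. \<Sum>l\<in>UNIV. \<Sum>s\<in>UNIV.
     of_real (weyl g x k v l s) * X $ k * Y $ v * Z $ l * V $ s)"

definition riemann_contract :: "metric_field \<Rightarrow> real^4 \<Rightarrow> complex^4 \<Rightarrow> complex^4 \<Rightarrow> complex^4 \<Rightarrow> complex^4 \<Rightarrow> complex" where
  "riemann_contract g x X Y Z V =
     (\<Sum>l\<in>UNIV. \<Sum>s\<in>UNIV. bilin (g x ** curvature_matrix g x l s) X Y * Z $ l * V $ s)"

definition ricci_matrix :: "metric_field \<Rightarrow> real^4 \<Rightarrow> real^4^4" where
  "ricci_matrix g x = (\<chi> b d. ricci g x b d)"

lemma bilin_transpose_mult: "bilin (transpose K ** A) X Y = bilin A (complex_mult_vec K X) Y"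
  by (simp add: bilin_def complex_mult_vec_def matrix_4_mult_nth transpose_def sum_4 algebra_simps)

lemma bilin_mult: "bilin (A ** K) X Y = bilin A X (complex_mult_vec K Y)"
  by (simp add: bilin_def complex_mult_vec_def matrix_4_mult_nth sum_4 algebra_simps)

lemma bilin_congruence:
  "bilin (transpose K ** A ** K) X Y = bilin A (complex_mult_vec K X) (complex_mult_vec K Y)"
  by (subst bilin_mult, subst bilin_transpose_mult, rule refl)

lemma bilin_add: "bilin (A + B) X Y = bilin A X Y + bilin B X Y"
  by (simp add: bilin_def sum.distrib algebra_simps)

lemma bilin_scaleR: "bilin (c *\<^sub>R A) X Y = of_real c * bilin A X Y"
  by (simp add: bilin_def sum_distrib_left algebra_simps)

lemma riemann_eq: "riemann g x p b c d = (g x ** curvature_matrix g x c d) $ p $ b"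
  by (simp add: riemann_def curvature_matrix_def matrix_matrix_mult_def)

lemma ricci_eq: "ricci g x b d = (\<Sum>e\<in>UNIV. curvature_matrix g x e d $ e $ b)"
  by (simp add: ricci_def curvature_matrix_def)

lemma scalar_curvature_eq:
  "scalar_curvature g x = trace (matrix_inv (g x) ** transpose (ricci_matrix g x))"
  by (simp add: scalar_curvature_def trace_def matrix_matrix_mult_def transpose_def ricci_matrix_def)

lemma sum_4_index_swap:
  fixes F :: "4 \<Rightarrow> 4 \<Rightarrow> 4 \<Rightarrow> 4 \<Rightarrow> complex"
  shows "(\<Sum>k\<in>UNIV. \<Sum>v\<in>UNIV. \<Sum>l\<in>UNIV. \<Sum>s\<in>UNIV. F k v l s)
    = (\<Sum>l\<in>UNIV. \<Sum>s\<in>UNIV. \<Sum>k\<in>UNIV. \<Sum>v\<in>UNIV. F k v l s)"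
proof -
  have "(\<Sum>k\<in>UNIV. \<Sum>v\<in>UNIV. \<Sum>l\<in>UNIV. \<Sum>s\<in>UNIV. F k v l s) = (\<Sum>k\<in>UNIV. \<Sum>l\<in>UNIV. \<Sum>v\<in>UNIV. \<Sum>s\<in>UNIV. F k v l s)"
    by (rule sum.cong[OF refl], rule sum.swap)
  also have "\<dots> = (\<Sum>l\<in>UNIV. \<Sum>k\<in>UNIV. \<Sum>v\<in>UNIV. \<Sum>s\<in>UNIV. F k v l s)"
    by (rule sum.swap)
  also have "\<dots> = (\<Sum>l\<in>UNIV. \<Sum>k\<in>UNIV. \<Sum>s\<in>UNIV. \<Sum>v\<in>UNIV. F k v l s)"
    by (rule sum.cong[OF refl], rule sum.cong[OF refl], rule sum.swap)
  also have "\<dots> = (\<Sum>l\<in>UNIV. \<Sum>s\<in>UNIV. \<Sum>k\<in>UNIV. \<Sum>v\<in>UNIV. F k v l s)"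
    by (rule sum.cong[OF refl], rule sum.swap)
  finally show ?thesis .
qed

text \<open>Splits the contraction into pieces with simple transformation laws: bilinear forms given
  by matrices, a trace, and the curvature two-form.\<close>

lemma weyl_contract_eq:
  "weyl_contract g x X Y Z V = riemann_contract g x X Y Z V
     - 1/2 * (bilin (g x) X Z * bilin (ricci_matrix g x) Y V - bilin (g x) X V * bilin (ricci_matrix g x) Y Z
            - bilin (g x) Y Z * bilin (ricci_matrix g x) X V + bilin (g x) Y V * bilin (ricci_matrix g x) X Z)
     + 1/6 * of_real (scalar_curvature g x)
         * (bilin (g x) X Z * bilin (g x) Y V - bilin (g x) X V * bilin (g x) Y Z)"
proof -
  have 1: "(\<Sum>k\<in>UNIV. \<Sum>v\<in>UNIV. \<Sum>l\<in>UNIV. (of_real (A$k$l) * X$k * Z$l)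
      * (\<Sum>s\<in>UNIV. of_real (C$v$s) * Y$v * V$s)) = bilin A X Z * bilin C Y V" for A C
    unfolding bilin_def sum_product unfolding sum_distrib_left ..
  have 2: "(\<Sum>k\<in>UNIV. \<Sum>v\<in>UNIV. \<Sum>l\<in>UNIV. \<Sum>s\<in>UNIV. (of_real (A$k$s) * X$k * V$s) * (of_real (C$v$l) * Y$v * Z$l))
      = bilin A X V * bilin C Y Z" for A C
    unfolding bilin_def sum_product by (intro sum.cong refl sum.swap)
  have 3: "(\<Sum>k\<in>UNIV. \<Sum>v\<in>UNIV. \<Sum>l\<in>UNIV. \<Sum>s\<in>UNIV. of_real (riemann g x k v l s) * X$k * Y$v * Z$l * V$s)
      = riemann_contract g x X Y Z V"
    unfolding riemann_contract_def bilin_def riemann_eq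
    by (subst sum_4_index_swap) (simp add: sum_distrib_right)
  let ?g = "\<lambda>i j. complex_of_real (g x $ i $ j)" and ?r = "\<lambda>i j. complex_of_real (ricci_matrix g x $ i $ j)"
  have "weyl_contract g x X Y Z V = (\<Sum>k\<in>UNIV. \<Sum>v\<in>UNIV. \<Sum>l\<in>UNIV. \<Sum>s\<in>UNIV.
      of_real (riemann g x k v l s) * X$k * Y$v * Z$l * V$s
     - (1/2 * ((?g k l * X$k * Z$l) * (?r v s * Y$v * V$s))
      - 1/2 * ((?g k s * X$k * V$s) * (?r v l * Y$v * Z$l))
      - 1/2 * ((?r k s * X$k * V$s) * (?g v l * Y$v * Z$l))
      + 1/2 * ((?r k l * X$k * Z$l) * (?g v s * Y$v * V$s)))
     + (1/6 * of_real (scalar_curvature g x) * ((?g k l * X$k * Z$l) * (?g v s * Y$v * V$s))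
      - 1/6 * of_real (scalar_curvature g x) * ((?g k s * X$k * V$s) * (?g v l * Y$v * Z$l))))"
    unfolding weyl_contract_def weyl_def ricci_matrix_def
    by (intro sum.cong refl) (simp add: field_simps)
  also have "\<dots> = riemann_contract g x X Y Z V
     - (1/2 * (bilin (g x) X Z * bilin (ricci_matrix g x) Y V)
      - 1/2 * (bilin (g x) X V * bilin (ricci_matrix g x) Y Z)
      - 1/2 * (bilin (ricci_matrix g x) X V * bilin (g x) Y Z)
      + 1/2 * (bilin (ricci_matrix g x) X Z * bilin (g x) Y V))
     + (1/6 * of_real (scalar_curvature g x) * (bilin (g x) X Z * bilin (g x) Y V)
      - 1/6 * of_real (scalar_curvature g x) * (bilin (g x) X V * bilin (g x) Y Z))"
    unfolding sum.distrib sum_subtractf sum_distrib_left[symmetric] 1 2 3 ..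
  finally show ?thesis
    by (simp add: algebra_simps)
qed

context
  fixes S :: "(real^4) set" and g :: metric_field
  assumes op: "open S" and g: "rt_matrix S g" and g_inv: "rt_matrix S (\<lambda>x. matrix_inv (g x))"
begin

lemma rt_matrix_curvature: "rt_matrix S (\<lambda>x. curvature_matrix g x c d)"
proof -
  note C = rt_matrix_christoffel[OF op g g_inv]
  show ?thesis
    unfolding curvature_matrix_eq
    by (intro rt_matrix_add rt_matrix_diff rt_matrix_mult rt_matrix_partial[OF op] C)
qed

lemma rt_smooth_weyl: "rt_smooth S (\<lambda>x. weyl g x p b c d)"
proof -
  note [intro] = rt_matrix_curvature[unfolded rt_matrix_def, THEN spec, THEN spec]
    g[unfolded rt_matrix_def, THEN spec, THEN spec] g_inv[unfolded rt_matrix_def, THEN spec, THEN spec]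
  have ric [intro]: "rt_smooth S (\<lambda>x. ricci g x b d)" for b d
    unfolding ricci_eq by (intro rt_smooth_sum) auto
  have [intro]: "rt_smooth S (\<lambda>x. scalar_curvature g x)"
    unfolding scalar_curvature_def by (intro rt_smooth_sum rt_smooth.mult) auto
  have [intro]: "rt_smooth S (\<lambda>x. riemann g x p b c d)" for p b c d
    unfolding riemann_eq matrix_matrix_mult_def by (auto intro!: rt_smooth_sum rt_smooth.mult)
  show ?thesis
    unfolding weyl_def
    by (intro rt_smooth.add rt_smooth_diff rt_smooth.mult rt_smooth.const) auto
qed

end

text \<open>To be applied to the Eddington-Finkelstein form on a set that includes the horizon. The
  two differentiations in the curvature cost nothing, since the class is closed under
  \<open>partial\<close>.\<close>

lemma complex_rt_smooth_weyl_contract: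
  assumes "open S" "rt_matrix S g" "rt_matrix S (\<lambda>x. matrix_inv (g x))"
    and "\<And>i. complex_rt_smooth S (\<lambda>x. X x $ i)" "\<And>i. complex_rt_smooth S (\<lambda>x. Y x $ i)"
    and "\<And>i. complex_rt_smooth S (\<lambda>x. Z x $ i)" "\<And>i. complex_rt_smooth S (\<lambda>x. V x $ i)"
  shows "complex_rt_smooth S (\<lambda>x. weyl_contract g x (X x) (Y x) (Z x) (V x))"
  unfolding weyl_contract_def
  by (intro complex_rt_smooth_sum complex_rt_smooth_mult complex_rt_smooth_of_real
      rt_smooth_weyl assms)

lemma weyl_contract_scale:
  "weyl_contract g x (c1 *s X) (c2 *s Y) (c3 *s Z) (c4 *s V) = c1 * c2 * c3 * c4 * weyl_contract g x X Y Z V"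
  by (simp add: weyl_contract_def sum_distrib_left algebra_simps)

section \<open>Changes of coordinates that shift t and phi by functions of r\<close>

lemma partial_3_radial: "partial 3 (\<lambda>x. f (x $ 2)) x = 0"
  by (simp add: partial_def)

text \<open>Together with the previous lemma this makes the mixed r, theta derivative of a radial
  function vanish.\<close>

lemma partial_2_radial: "\<exists>f'. partial 2 (\<lambda>x. f (x $ 2)) = (\<lambda>x. f' (x $ 2))"
  unfolding partial_def by (rule exI[of _ "\<lambda>r. vector_derivative (\<lambda>s. f (r + s)) (at 0)"]) simp

text \<open>Transformation laws under a shear, separated from the particular metric. That
  \<open>u\<close> and \<open>v\<close> are functions of r alone makes the shear the Jacobian of an
  actual coordinate change. \<open>h\<close> is tied to \<open>g\<close> on \<open>S\<close> only,
  so it may stay regular beyond \<open>S\<close>.\<close>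

locale shear_gauge =
  fixes S :: "(real^4) set" and g h :: metric_field and fu fv :: "real \<Rightarrow> real"
    and u v :: "real^4 \<Rightarrow> real"
  defines "u \<equiv> \<lambda>x. fu (x $ 2)" and "v \<equiv> \<lambda>x. fv (x $ 2)"
  assumes op: "open S"
    and g: "rt_matrix S g" and g_inv: "rt_matrix S (\<lambda>x. matrix_inv (g x))"
    and g_inv_left: "\<And>x. x \<in> S \<Longrightarrow> matrix_inv (g x) ** g x = mat 1"
    and g_sym: "\<And>x. x \<in> S \<Longrightarrow> transpose (g x) = g x"
    and u: "rt_smooth S u" and v: "rt_smooth S v"
    and h: "\<And>x. x \<in> S \<Longrightarrow> h x = transpose (shear (u x) (v x)) ** g x ** shear (u x) (v x)"
begin

definition "K x = shear (u x) (v x)"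
definition "L x = shear (- u x) (- v x)"
definition "D x = shear_part (partial 2 u x) (partial 2 v x)"

lemma rt_K: "rt_matrix S K" and rt_L: "rt_matrix S L" and rt_D: "rt_matrix S D"
  unfolding rt_matrix_def forall_4 K_def L_def D_def shear_def shear_part_def
  by (simp_all add: rt_smooth_intros rt_smooth_partial[OF op] u v)

lemma KL: "K x ** L x = mat 1" "L x ** K x = mat 1"
  by (simp_all add: K_def L_def shear_mult)

lemma KD: "K x ** D x = D x" "D x ** K x = D x" "L x ** D x = D x" "D x ** L x = D x" "D x ** D x = 0"
  by (simp_all add: K_def L_def D_def shear_mult)

lemma partial_3_u_v: "partial 3 u x = 0" "partial 3 v x = 0"
  by (simp_all add: u_def v_def partial_3_radial)

lemma partial_K:
  assumes "x \<in> S" shows "partial_matrix i K x = (if i = 2 then D x else 0)"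
proof -
  have c: "partial i (\<lambda>x. c) x = 0" for c :: real
    by (simp add: partial_def)
  show ?thesis
    using assms exhaust_4[of i]
    by (auto simp: matrix_4_eq_iff partial_matrix_def K_def D_def shear_def shear_part_def c
        rt_smooth_partial_1_4[OF op] u v partial_3_u_v)
qed

lemma partial_L:
  assumes "x \<in> S" shows "partial_matrix i L x = (if i = 2 then - D x else 0)"
proof -
  have c: "partial i (\<lambda>x. c) x = 0" for c :: real
    by (simp add: partial_def)
  have m: "partial i (\<lambda>y. - f y) x = - partial i f x" if "rt_smooth S f" for f
    using partial_rt_mult[OF op rt_smooth.const[of S "-1"] that assms, of i] c by simp
  show ?thesis
    using assms exhaust_4[of i]
    by (auto simp: matrix_4_eq_iff partial_matrix_def L_def D_def shear_def shear_part_def c m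
        rt_smooth_partial_1_4[OF op] u v partial_3_u_v)
qed

text \<open>\<open>D\<close> holds the second derivatives of the coordinate change, and its entries
  are again functions of r. The remaining r-derivative of \<open>D\<close> will drop out of the
  curvature by antisymmetry.\<close>

lemma partial_D:
  assumes "x \<in> S" "i \<noteq> 2" shows "partial_matrix i D x = 0"
proof -
  have c: "partial i (\<lambda>x. c) x = 0" for c :: real
    by (simp add: partial_def)
  obtain u' v' where "partial 2 u = (\<lambda>x. u' (x $ 2))" "partial 2 v = (\<lambda>x. v' (x $ 2))"
    using partial_2_radial[of fu] partial_2_radial[of fv] unfolding u_def v_def by blast
  then have p3: "partial 3 (partial 2 u) x = 0" "partial 3 (partial 2 v) x = 0"
    by (simp_all add: partial_3_radial)
  show ?thesis
    using assms exhaust_4[of i] p3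
    by (auto simp: matrix_4_eq_iff partial_matrix_def D_def shear_part_def c
        rt_smooth_partial_1_4[OF op] rt_smooth_partial[OF op] u v)
qed

lemma h_inv:
  assumes "x \<in> S" shows "matrix_inv (h x) = L x ** matrix_inv (g x) ** transpose (L x)"
proof (rule matrix_inv_eqI)
  have "transpose (K x) ** transpose (L x) = mat 1"
    using KL(2)[of x] by (metis matrix_transpose_mul transpose_mat)
  moreover have "g x ** matrix_inv (g x) = mat 1"
    using g_inv_left[OF assms] matrix_left_right_inverse by blast
  moreover have "h x ** (L x ** matrix_inv (g x) ** transpose (L x))
     = transpose (K x) ** (g x ** ((K x ** L x) ** matrix_inv (g x))) ** transpose (L x)"
    by (simp add: h[OF assms] K_def matrix_mul_assoc)
  ultimately show "h x ** (L x ** matrix_inv (g x) ** transpose (L x)) = mat 1"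
    by (simp add: KL)
qed

lemma partial_h:
  assumes "x \<in> S"
  shows "partial_matrix i h x = transpose (K x) ** partial_matrix i g x ** K x
     + (if i = 2 then transpose (D x) ** g x ** K x + transpose (K x) ** g x ** D x else 0)"
proof -
  have "partial_matrix i h x = partial_matrix i (\<lambda>y. transpose (K y) ** g y ** K y) x"
    by (rule partial_matrix_cong[OF op _ assms])
      (use h in \<open>auto intro!: rt_matrix_mult rt_matrix_transpose rt_K[unfolded K_def] g simp: K_def\<close>)
  also have "\<dots> = partial_matrix i (\<lambda>y. transpose (K y)) x ** g x ** K x
     + transpose (K x) ** partial_matrix i g x ** K x + transpose (K x) ** g x ** partial_matrix i K x"
    by (simp add: partial_matrix_mult[OF op] rt_matrix_mult rt_matrix_transpose rt_K g assms
        matrix_mult_distribs)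
  finally show ?thesis
    by (simp add: partial_matrix_transpose partial_K assms matrix_mult_distribs)
qed

text \<open>Pullback of a matrix-valued one-form along the shear: the new radial coordinate vector
  is the old one plus \<open>u\<close> times the t-direction and \<open>v\<close> times the
  phi-direction, while the other three are unchanged.\<close>

definition "B M x a = (if a = 2 then M 2 + u x *\<^sub>R M 1 + v x *\<^sub>R M 4 else M a)" for M :: "4 \<Rightarrow> real^4^4"

text \<open>Symbols of the first kind transform as a tensor up to the metric contracted with second
  derivatives of the coordinate change. The latter are nonzero only when both differentiations are
  in r, hence the extra term at \<open>a = 2\<close>.\<close>

lemma christoffel_lowered_h:
  assumes x: "x \<in> S"
  shows "christoffel_lowered h x a = transpose (K x) ** B (christoffel_lowered g x) x a ** K x
    + (if a = 2 then transpose (K x) ** g x ** D x else 0)"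
proof -
  \<comment> \<open>Orients the off-diagonal entries of symmetric matrices, so that the entrywise
    identities below reduce to polynomial ones.\<close>
  have s: "M$2$1 = M$1$2" "M$3$1 = M$1$3" "M$4$1 = M$1$4" "M$3$2 = M$2$3" "M$4$2 = M$2$4" "M$4$3 = M$3$4"
    if "transpose M = M" for M :: "real^4^4"
    by (rule symmetric_matrix_nth[OF that])+
  have sp: "transpose (partial_matrix i g x) = partial_matrix i g x" for i
    using partial_matrix_cong[OF op g x, of "\<lambda>y. transpose (g y)"] g_sym
    by (simp add: partial_matrix_transpose)
  note z = partial_matrix_1_4[OF op g x]
  show ?thesis
    using exhaust_4[of a]
    by (elim disjE; simp add: matrix_4_eq_iff christoffel_lowered_def partial_h[OF x] z B_def;
      simp add: matrix_4_mult_nth K_def D_def shear_def shear_part_def transpose_def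
       s[OF g_sym[OF x]] s[OF sp] z algebra_simps add_divide_distrib diff_divide_distrib)
qed

lemma B_mult: "A ** B M x a = B (\<lambda>i. A ** M i) x a" "B M x a ** A = B (\<lambda>i. M i ** A) x a"
  by (simp_all add: B_def matrix_mult_distribs)

lemma B_if: "B M x a = (if a = 2 then B M x 2 else M a)"
  by (simp add: B_def)

text \<open>The inhomogeneous term \<open>D\<close> is \<open>K\<^sup>-\<^sup>1 \<partial>\<^sub>r K\<close>.\<close>

lemma christoffel_matrix_h:
  assumes x: "x \<in> S"
  shows "christoffel_matrix h x a = L x ** B (christoffel_matrix g x) x a ** K x + (if a = 2 then D x else 0)"
proof -
  have KLt: "transpose (L x) ** transpose (K x) = mat 1"
    using KL(1)[of x] by (metis matrix_transpose_mul transpose_mat)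
  then have *: "transpose (L x) ** (transpose (K x) ** A) = A" for A
    by (simp add: matrix_mul_assoc)
  have "matrix_inv (g x) ** (g x ** D x) = D x"
    by (simp add: matrix_mul_assoc g_inv_left[OF x])
  then have "christoffel_matrix h x a =
      L x ** (matrix_inv (g x) ** (B (christoffel_lowered g x) x a ** K x)) + (if a = 2 then D x else 0)"
    by (simp add: christoffel_matrix_eq h_inv[OF x] christoffel_lowered_h[OF x] matrix_mult_distribs
        matrix_mul_assoc[symmetric] * KD)
  also have "matrix_inv (g x) ** (B (christoffel_lowered g x) x a ** K x)
      = B (christoffel_matrix g x) x a ** K x"
    by (simp add: matrix_mul_assoc B_mult christoffel_matrix_eq)
  finally show ?thesis
    by (simp add: matrix_mul_assoc)
qed

lemma rt_christoffel: "rt_matrix S (\<lambda>x. christoffel_matrix g x i)"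
  by (rule rt_matrix_christoffel[OF op g g_inv])

lemma rt_B: "rt_matrix S (\<lambda>x. B (christoffel_matrix g x) x i)"
  unfolding B_def
  by (cases "i = 2"; simp add: rt_christoffel rt_matrix_add rt_matrix_scaleR u v)

lemma partial_christoffel_h:
  assumes x: "x \<in> S"
  shows "partial_matrix i (\<lambda>y. christoffel_matrix h y j) x =
     L x ** partial_matrix i (\<lambda>y. B (christoffel_matrix g y) y j) x ** K x
     + (if i = 2 then L x ** B (christoffel_matrix g x) x j ** D x - D x ** B (christoffel_matrix g x) x j ** K x else 0)
     + (if j = 2 then partial_matrix i D x else 0)"
proof -
  let ?N = "\<lambda>y. L y ** B (christoffel_matrix g y) y j ** K y"
  have rN: "rt_matrix S ?N" and rLB: "rt_matrix S (\<lambda>y. L y ** B (christoffel_matrix g y) y j)"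
    and rD: "rt_matrix S (\<lambda>y. if j = 2 then D y else 0)"
    by (cases "j = 2"; simp add: rt_matrix_mult rt_L rt_B rt_K rt_D rt_matrix_const)+
  have "partial_matrix i (\<lambda>y. christoffel_matrix h y j) x
      = partial_matrix i (\<lambda>y. ?N y + (if j = 2 then D y else 0)) x"
    by (rule partial_matrix_cong[OF op rt_matrix_add[OF rN rD] x christoffel_matrix_h])
  also have "\<dots> = partial_matrix i ?N x + partial_matrix i (\<lambda>y. if j = 2 then D y else 0) x"
    by (rule partial_matrix_add[OF op rN rD x])
  also have "partial_matrix i (\<lambda>y. if j = 2 then D y else 0) x = (if j = 2 then partial_matrix i D x else 0)"
    by (simp add: partial_matrix_def partial_def vec_eq_iff)
  also have "partial_matrix i ?N x = (partial_matrix i L x ** B (christoffel_matrix g x) x j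
       + L x ** partial_matrix i (\<lambda>y. B (christoffel_matrix g y) y j) x) ** K x
     + L x ** B (christoffel_matrix g x) x j ** partial_matrix i K x"
    by (simp add: partial_matrix_mult[OF op rLB rt_K x] partial_matrix_mult[OF op rt_L rt_B x])
  finally show ?thesis
    by (simp add: partial_K[OF x] partial_L[OF x] matrix_mult_distribs)
qed

lemma partial_B:
  assumes x: "x \<in> S" and "i \<noteq> 2"
  shows "partial_matrix i (\<lambda>y. B (christoffel_matrix g y) y j) x
    = B (\<lambda>j. partial_matrix i (\<lambda>y. christoffel_matrix g y j) x) x j"
proof -
  have "partial i u x = 0" "partial i v x = 0"
    using exhaust_4[of i] assms by (auto simp: partial_3_u_v rt_smooth_partial_1_4[OF op] u v)
  then show ?thesis
    unfolding B_def using rt_christoffel x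
    by (simp add: partial_matrix_add[OF op] partial_matrix_scaleR[OF op] u v rt_matrix_add rt_matrix_scaleR)
qed

lemma curvature_matrix_swap: "curvature_matrix f x c d = - curvature_matrix f x d c"
  by (simp add: curvature_matrix_eq)

text \<open>A gauge transformation: \<open>L\<close> and \<open>K\<close> act on the endomorphism,
  \<open>B\<close> pulls back each index of the two-form. Differentiating \<open>L\<close> and
  \<open>K\<close> yields exactly the commutator with \<open>D\<close>, so all inhomogeneous terms
  cancel.\<close>

lemma curvature_matrix_h:
  assumes x: "x \<in> S"
  shows "curvature_matrix h x c d = L x ** B (\<lambda>i. B (curvature_matrix g x i) x d) x c ** K x"
proof -
  have KX: "K x ** (L x ** X) = X" "K x ** (D x ** X) = D x ** X" "D x ** (K x ** X) = D x ** X"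
     "L x ** (D x ** X) = D x ** X" "D x ** (L x ** X) = D x ** X" "D x ** (D x ** X) = 0" for X
    by (simp_all add: matrix_mul_assoc KL KD)
  note [simp] = matrix_mult_distribs matrix_mul_assoc[symmetric] KX KD KL
  \<comment> \<open>By stationarity and axial symmetry the new radial derivative acts on these
    fields as the old one; the terms with \<open>u\<close> and \<open>v\<close> in the pullback need
    no derivatives in t or phi.\<close>
  have z: "partial_matrix 1 (\<lambda>y. christoffel_matrix g y j) x = 0"
    "partial_matrix 4 (\<lambda>y. christoffel_matrix g y j) x = 0" for j
    by (simp_all add: partial_matrix_1_4[OF op] rt_christoffel x)
  have 1: "curvature_matrix h x c d = L x ** B (\<lambda>i. B (curvature_matrix g x i) x d) x c ** K x" if "c \<noteq> 2" "d \<noteq> 2" for c d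
    using that by (simp add: curvature_matrix_eq partial_christoffel_h[OF x] christoffel_matrix_h[OF x]
        partial_B[OF x] B_if[of _ _ c] B_if[of _ _ d])
  have 2: "curvature_matrix h x c 2 = L x ** B (\<lambda>i. B (curvature_matrix g x i) x 2) x c ** K x"
    if "c \<noteq> 2" for c
    using that by (simp add: curvature_matrix_eq partial_christoffel_h[OF x] christoffel_matrix_h[OF x]
        partial_B[OF x] partial_D[OF x] B_if[of _ _ c]; simp add: curvature_matrix_eq B_def z algebra_simps)
  have 3: "curvature_matrix h x 2 d = L x ** B (\<lambda>i. B (curvature_matrix g x i) x d) x 2 ** K x"
    if "d \<noteq> 2" for d
    using 2[OF that] curvature_matrix_swap[of h x 2 d] curvature_matrix_swap[of g x _ d] that
    by (simp add: B_def algebra_simps)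
  \<comment> \<open>Both indices are r: the two-form is evaluated twice on the same vector, and its
    terms cancel in pairs.\<close>
  have 4: "curvature_matrix h x 2 2 = L x ** B (\<lambda>i. B (curvature_matrix g x i) x 2) x 2 ** K x"
  proof -
    have 0: "curvature_matrix f x i i = 0" for f i
      by (simp add: curvature_matrix_eq)
    note [simp] = curvature_matrix_swap[of g x 2 1] curvature_matrix_swap[of g x 4 2]
      curvature_matrix_swap[of g x 4 1]
    show ?thesis
      by (simp add: 0 B_def algebra_simps)
  qed
  show ?thesis
    using 1 2 3 4 by (cases "c = 2"; cases "d = 2") blast+
qed

lemma bilin_h: "x \<in> S \<Longrightarrow> bilin (h x) X Y = bilin (g x) (complex_mult_vec (K x) X) (complex_mult_vec (K x) Y)"
  by (simp add: h K_def bilin_congruence)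

lemma h_curvature_matrix_h:
  assumes "x \<in> S"
  shows "h x ** curvature_matrix h x c d
    = transpose (K x) ** (g x ** B (\<lambda>i. B (curvature_matrix g x i) x d) x c) ** K x"
proof -
  have "K x ** (L x ** A) = A" for A :: "real^4^4"
    by (simp add: matrix_mul_assoc KL)
  then show ?thesis
    by (simp add: h[OF assms, folded K_def] curvature_matrix_h[OF assms] matrix_mul_assoc[symmetric])
qed

lemma complex_mult_vec_K:
  "complex_mult_vec (K x) X $ 1 = X $ 1 + of_real (u x) * X $ 2"
  "complex_mult_vec (K x) X $ 2 = X $ 2"
  "complex_mult_vec (K x) X $ 3 = X $ 3"
  "complex_mult_vec (K x) X $ 4 = X $ 4 + of_real (v x) * X $ 2"
  by (simp_all add: complex_mult_vec_def K_def shear_def sum_4)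

text \<open>Congruence with \<open>K\<close> moves onto \<open>X\<close> and \<open>Y\<close>. By
  linearity the two pullbacks \<open>B\<close> move onto \<open>Z\<close> and \<open>V\<close>,
  where they become the same action of \<open>K\<close>.\<close>

lemma riemann_contract_h:
  assumes "x \<in> S"
  shows "riemann_contract h x X Y Z V = riemann_contract g x (complex_mult_vec (K x) X)
     (complex_mult_vec (K x) Y) (complex_mult_vec (K x) Z) (complex_mult_vec (K x) V)"
  unfolding riemann_contract_def h_curvature_matrix_h[OF assms] bilin_congruence sum_4
    complex_mult_vec_K
  by (simp add: B_def bilin_add bilin_scaleR matrix_mult_distribs algebra_simps)

lemma ricci_matrix_h:
  assumes "x \<in> S"
  shows "ricci_matrix h x = transpose (K x) ** ricci_matrix g x ** K x"
proof -
  have "ricci_matrix h x $ b $ d = (transpose (K x) ** ricci_matrix g x ** K x) $ b $ d" for b d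
    using exhaust_4[of b] exhaust_4[of d]
    by (elim disjE; simp add: ricci_matrix_def ricci_eq curvature_matrix_h[OF assms] sum_4 matrix_4_mult_nth
       B_def K_def L_def shear_def transpose_def; simp add: algebra_simps)
  then show ?thesis
    by (simp add: vec_eq_iff)
qed

lemma scalar_curvature_h:
  assumes "x \<in> S"
  shows "scalar_curvature h x = scalar_curvature g x"
proof -
  have KLt: "transpose (L x) ** transpose (K x) = mat 1"
    using KL(1)[of x] by (metis matrix_transpose_mul transpose_mat)
  then have *: "transpose (L x) ** (transpose (K x) ** A) = A" for A :: "real^4^4"
    by (simp add: matrix_mul_assoc)
  have "scalar_curvature h x = trace (L x ** (matrix_inv (g x) ** transpose (ricci_matrix g x) ** K x))"
    by (simp add: scalar_curvature_eq h_inv[OF assms] ricci_matrix_h[OF assms] matrix_transpose_mul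
        matrix_mul_assoc[symmetric] *)
  also have "\<dots> = trace (matrix_inv (g x) ** transpose (ricci_matrix g x) ** (K x ** L x))"
    by (subst trace_mul_sym) (simp add: matrix_mul_assoc)
  finally show ?thesis
    by (simp add: KL scalar_curvature_eq)
qed

text \<open>Tensoriality of the Weyl curvature under the shear; it allows the contraction with the
  tetrad to be computed from the regular metric.\<close>

lemma weyl_contract_h:
  assumes "x \<in> S"
  shows "weyl_contract h x X Y Z V = weyl_contract g x (complex_mult_vec (K x) X)
     (complex_mult_vec (K x) Y) (complex_mult_vec (K x) Z) (complex_mult_vec (K x) V)"
  by (simp add: weyl_contract_eq riemann_contract_h bilin_h ricci_matrix_h scalar_curvature_h
      bilin_congruence assms)

end

section \<open>The accelerating Kerr-Newman-(anti-)de Sitter spacetime\<close>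

locale akn_spacetime =
  fixes a m q \<Lambda> \<alpha> :: real
begin

abbreviation "g \<equiv> akn_metric a m q \<Lambda> \<alpha>"
abbreviation "U \<equiv> akn_domain a m q \<Lambda> \<alpha>"
abbreviation "V \<equiv> akn_tetrad_domain a m q \<Lambda> \<alpha>"

section \<open>The metric functions and the two domains\<close>

definition Om :: "real^4 \<Rightarrow> real" where "Om x = akn_Omega \<alpha> (x $ 2) (x $ 3)"
definition w :: "real^4 \<Rightarrow> real" where "w x = (x $ 2)\<^sup>2 + a\<^sup>2 * (cos (x $ 3))\<^sup>2"
definition b :: "real^4 \<Rightarrow> real" where "b x = (x $ 2)\<^sup>2 + a\<^sup>2"
definition P :: "real^4 \<Rightarrow> real" where "P x = akn_P a m q \<Lambda> \<alpha> (x $ 3)"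
definition Q :: "real^4 \<Rightarrow> real" where "Q x = akn_Q a m q \<Lambda> \<alpha> (x $ 2)"
definition s :: "real^4 \<Rightarrow> real" where "s x = sin (x $ 3)"

text \<open>Eliminating \<open>b\<close> turns the matrix identities below into rational identities
  in which \<open>w\<close>, \<open>s\<close>, \<open>P\<close>, \<open>Q\<close> may be treated as
  independent.\<close>

lemma b_eq: "b x = w x + a\<^sup>2 * (s x)\<^sup>2"
  by (simp add: b_def w_def s_def sin_squared_eq algebra_simps)

lemma w_nonneg: "w x \<ge> 0"
  by (simp add: w_def)

lemma rho_eq: "akn_rho a (x $ 2) (x $ 3) = sqrt (w x)"
  by (simp add: akn_rho_def w_def)

lemma in_U: "x \<in> U \<longleftrightarrow> Om x > 0 \<and> w x > 0 \<and> P x > 0 \<and> 0 < x $ 3 \<and> x $ 3 < pi"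
  using w_nonneg[of x] by (auto simp: akn_domain_def Om_def P_def rho_eq less_le)

lemma in_V: "x \<in> V \<longleftrightarrow> x \<in> U \<and> Q x > 0"
  by (simp add: akn_tetrad_domain_def Q_def)

lemma U_pos: "x \<in> U \<Longrightarrow> Om x > 0" "x \<in> U \<Longrightarrow> w x > 0" "x \<in> U \<Longrightarrow> P x > 0" "x \<in> U \<Longrightarrow> s x > 0"
  by (auto simp: in_U s_def sin_gt_zero)

lemma U_nz: "x \<in> U \<Longrightarrow> Om x \<noteq> 0" "x \<in> U \<Longrightarrow> w x \<noteq> 0" "x \<in> U \<Longrightarrow> P x \<noteq> 0" "x \<in> U \<Longrightarrow> s x \<noteq> 0"
  using U_pos by fastforce+

lemma VU: "V \<subseteq> U"
  by (auto simp: in_V)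

lemma open_U: "open U"
proof -
  have "U = {x. Om x > 0 \<and> w x > 0 \<and> P x > 0 \<and> 0 < x $ 3 \<and> x $ 3 < pi}"
    by (auto simp: in_U)
  also have "open \<dots>"
    unfolding Om_def w_def P_def akn_Omega_def akn_P_def
    by (intro open_Collect_conj open_Collect_less continuous_intros)
  finally show ?thesis .
qed

lemma open_V: "open V"
proof -
  have "open {x. Q x > 0}"
    unfolding Q_def akn_Q_def by (intro open_Collect_less continuous_intros)
  moreover have "V = U \<inter> {x. Q x > 0}"
    by (auto simp: in_V)
  ultimately show ?thesis
    using open_U by auto
qed

lemma rt_basic:
  "rt_smooth S Om" "rt_smooth S w" "rt_smooth S b" "rt_smooth S P" "rt_smooth S Q" "rt_smooth S s"
  unfolding Om_def[abs_def] w_def[abs_def] b_def[abs_def] P_def[abs_def] Q_def[abs_def] s_def[abs_def]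
    akn_Omega_def akn_P_def akn_Q_def
  by (intro rt_smooth_intros)+

section \<open>The metric in the given and in Eddington-Finkelstein coordinates\<close>

text \<open>
  \<open>ef_core\<close> below is \<open>g_core\<close> in Eddington-Finkelstein coordinates (\<open>u = (r\<^sup>2 + a\<^sup>2) / Q\<close>, \<open>v = a / Q\<close>);
  neither it nor its inverse divides by \<open>Q\<close>.
\<close>

definition g_core :: "real^4 \<Rightarrow> real^4^4" where
  "g_core x = vector
    [vector [- Q x / w x + P x * (s x)\<^sup>2 * a\<^sup>2 / w x, 0, 0, Q x * a * (s x)\<^sup>2 / w x - P x * (s x)\<^sup>2 * a * b x / w x],
     vector [0, w x / Q x, 0, 0],
     vector [0, 0, w x / P x, 0],
     vector [Q x * a * (s x)\<^sup>2 / w x - P x * (s x)\<^sup>2 * a * b x / w x, 0, 0,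
             - Q x * a\<^sup>2 * (s x)^4 / w x + P x * (s x)\<^sup>2 * (b x)\<^sup>2 / w x]]"

definition g_core_inv :: "real^4 \<Rightarrow> real^4^4" where
  "g_core_inv x = vector
    [vector [- (b x)\<^sup>2 / (Q x * w x) + a\<^sup>2 * (s x)\<^sup>2 / (P x * w x), 0, 0, - b x * a / (Q x * w x) + a / (P x * w x)],
     vector [0, Q x / w x, 0, 0],
     vector [0, 0, P x / w x, 0],
     vector [- b x * a / (Q x * w x) + a / (P x * w x), 0, 0,
             - a\<^sup>2 / (Q x * w x) + 1 / (P x * w x * (s x)\<^sup>2)]]"

definition ef_core :: "real^4 \<Rightarrow> real^4^4" where
  "ef_core x = vector
    [vector [- Q x / w x + P x * (s x)\<^sup>2 * a\<^sup>2 / w x, - 1, 0, Q x * a * (s x)\<^sup>2 / w x - P x * (s x)\<^sup>2 * a * b x / w x],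
     vector [- 1, 0, 0, a * (s x)\<^sup>2],
     vector [0, 0, w x / P x, 0],
     vector [Q x * a * (s x)\<^sup>2 / w x - P x * (s x)\<^sup>2 * a * b x / w x, a * (s x)\<^sup>2, 0,
             - Q x * a\<^sup>2 * (s x)^4 / w x + P x * (s x)\<^sup>2 * (b x)\<^sup>2 / w x]]"

definition ef_core_inv :: "real^4 \<Rightarrow> real^4^4" where
  "ef_core_inv x = vector
    [vector [a\<^sup>2 * (s x)\<^sup>2 / (P x * w x), - b x / w x, 0, a / (P x * w x)],
     vector [- b x / w x, Q x / w x, 0, - a / w x],
     vector [0, 0, P x / w x, 0],
     vector [a / (P x * w x), - a / w x, 0, 1 / (P x * w x * (s x)\<^sup>2)]]"

definition ef :: metric_field where "ef x = (1 / (Om x)\<^sup>2) *\<^sub>R ef_core x"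

lemma g_eq: "g x = (1 / (Om x)\<^sup>2) *\<^sub>R g_core x"
proof -
  have r: "(akn_rho a (x $ 2) (x $ 3))\<^sup>2 = w x"
    by (simp add: rho_eq w_nonneg)
  have c: "akn_Omega \<alpha> (x $ 2) (x $ 3) = Om x" "akn_P a m q \<Lambda> \<alpha> (x $ 3) = P x"
     "akn_Q a m q \<Lambda> \<alpha> (x $ 2) = Q x" "sin (x $ 3) = s x" "(x $ 2)\<^sup>2 + a\<^sup>2 = b x"
    by (simp_all add: Om_def P_def Q_def s_def b_def)
  show ?thesis
    unfolding akn_metric_def Let_def r c
    by (simp add: matrix_4_eq_iff g_core_def power2_eq_square power4_eq_xxxx algebra_simps)
qed

lemma g_core_mult: "x \<in> V \<Longrightarrow> g_core x ** g_core_inv x = mat 1"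
  using U_nz[of x] unfolding in_V
  by (simp add: matrix_4_eq_iff matrix_4_mult_nth mat_1_nth g_core_def g_core_inv_def b_eq)
    (simp add: divide_simps, algebra)

lemma ef_core_mult: "x \<in> U \<Longrightarrow> ef_core x ** ef_core_inv x = mat 1"
  using U_nz[of x]
  by (simp add: matrix_4_eq_iff matrix_4_mult_nth mat_1_nth ef_core_def ef_core_inv_def b_eq)
    (simp add: divide_simps, algebra)

lemma g_inverse: "x \<in> V \<Longrightarrow> matrix_inv (g x) = (Om x)\<^sup>2 *\<^sub>R g_core_inv x"
  using U_nz(1)[of x] g_core_mult[of x]
  by (intro matrix_inv_eqI) (auto simp: g_eq in_V matrix_mult_distribs)

lemma ef_inverse: "x \<in> U \<Longrightarrow> matrix_inv (ef x) = (Om x)\<^sup>2 *\<^sub>R ef_core_inv x"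
  using U_nz(1)[of x] ef_core_mult[of x]
  by (intro matrix_inv_eqI) (auto simp: ef_def matrix_mult_distribs)

lemma rt_ef: "rt_matrix U ef"
  using U_nz unfolding rt_matrix_def forall_4 ef_def ef_core_def
  by (auto intro!: rt_smooth_intros rt_basic)

lemma rt_ef_inv: "rt_matrix U (\<lambda>x. matrix_inv (ef x))"
proof (rule rt_matrix_cong[OF _ ef_inverse])
  show "rt_matrix U (\<lambda>x. (Om x)\<^sup>2 *\<^sub>R ef_core_inv x)"
    using U_nz unfolding rt_matrix_def forall_4 ef_core_inv_def
    by (auto intro!: rt_smooth_intros rt_basic)
qed

lemma V_nz: "x \<in> V \<Longrightarrow> Om x \<noteq> 0" "x \<in> V \<Longrightarrow> w x \<noteq> 0" "x \<in> V \<Longrightarrow> P x \<noteq> 0" "x \<in> V \<Longrightarrow> s x \<noteq> 0"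
   "x \<in> V \<Longrightarrow> Q x \<noteq> 0"
  using U_nz by (auto simp: in_V)

lemma rt_g: "rt_matrix V g"
  using V_nz unfolding rt_matrix_def forall_4 g_eq g_core_def
  by (auto intro!: rt_smooth_intros rt_basic)

lemma rt_g_inv: "rt_matrix V (\<lambda>x. matrix_inv (g x))"
proof (rule rt_matrix_cong[OF _ g_inverse])
  show "rt_matrix V (\<lambda>x. (Om x)\<^sup>2 *\<^sub>R g_core_inv x)"
    using V_nz unfolding rt_matrix_def forall_4 g_core_inv_def
    by (auto intro!: rt_smooth_intros rt_basic)
qed

text \<open>The new radial coordinate vector is proportional to \<open>l\<close>, hence null. It is
  annihilated by \<open>a dt - (r^2 + a^2) dphi\<close>, while \<open>dt - a sin^2 dphi\<close>
  takes the value \<open>w / Q\<close> on it, because \<open>b - a^2 s^2 = w\<close>. So the two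
  singular contributions \<open>- w / Q\<close> and \<open>w / Q\<close> to the rr entry
  cancel.\<close>

sublocale ef: shear_gauge V g ef "\<lambda>r. (r\<^sup>2 + a\<^sup>2) / akn_Q a m q \<Lambda> \<alpha> r" "\<lambda>r. a / akn_Q a m q \<Lambda> \<alpha> r"
  "\<lambda>x. ((x $ 2)\<^sup>2 + a\<^sup>2) / akn_Q a m q \<Lambda> \<alpha> (x $ 2)" "\<lambda>x. a / akn_Q a m q \<Lambda> \<alpha> (x $ 2)"
proof unfold_locales
  fix x assume x: "x \<in> V"
  show "matrix_inv (g x) ** g x = mat 1"
    using V_nz(1)[OF x] matrix_left_right_inverse[THEN iffD1, OF g_core_mult[OF x]]
    by (simp add: g_inverse[OF x]) (simp add: g_eq matrix_mult_distribs)
  show "transpose (g x) = g x"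
    by (simp add: g_eq matrix_4_eq_iff g_core_def transpose_def)
  show "ef x = transpose (shear (((x $ 2)\<^sup>2 + a\<^sup>2) / akn_Q a m q \<Lambda> \<alpha> (x $ 2)) (a / akn_Q a m q \<Lambda> \<alpha> (x $ 2)))
     ** g x ** shear (((x $ 2)\<^sup>2 + a\<^sup>2) / akn_Q a m q \<Lambda> \<alpha> (x $ 2)) (a / akn_Q a m q \<Lambda> \<alpha> (x $ 2))"
    unfolding b_def[symmetric] Q_def[symmetric] g_eq ef_def matrix_mult_distribs scaleR_cancel_left
    using V_nz[OF x]
    by (intro disjI1) (simp add: matrix_4_eq_iff matrix_4_mult_nth ef_core_def g_core_def shear_def transpose_def
       b_eq; simp add: divide_simps; algebra)
next
  show "rt_smooth V (\<lambda>x. ((x $ 2)\<^sup>2 + a\<^sup>2) / akn_Q a m q \<Lambda> \<alpha> (x $ 2))"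
    "rt_smooth V (\<lambda>x. a / akn_Q a m q \<Lambda> \<alpha> (x $ 2))"
    unfolding b_def[symmetric] Q_def[symmetric]
    using V_nz by (auto intro!: rt_smooth_divide rt_basic rt_smooth.const)
qed (auto intro: open_V rt_g rt_g_inv)

section \<open>Extension of the Weyl scalar across the horizon\<close>

text \<open>
  The tetrad in Eddington-Finkelstein coordinates, up to factors. Those of \<open>Lh\<close> and \<open>Nh\<close>
  are proportional to \<open>sqrt Q\<close> and \<open>1 / sqrt Q\<close>, and cancel in \<open>\<Psi>\<^sub>2\<close>.
\<close>

definition Mh :: "real^4 \<Rightarrow> complex^4" where
  "Mh x = vector [of_real (a * s x), 0, \<i> * of_real (P x), of_real (1 / s x)]"
definition Mbh :: "real^4 \<Rightarrow> complex^4" where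
  "Mbh x = vector [of_real (a * s x), 0, - \<i> * of_real (P x), of_real (1 / s x)]"
definition Nh :: "real^4 \<Rightarrow> complex^4" where
  "Nh x = vector [of_real (2 * b x), - of_real (Q x), 0, of_real (2 * a)]"
definition Lh :: "real^4 \<Rightarrow> complex^4" where
  "Lh x = vector [0, 1, 0, 0]"

text \<open>The prefactor collects the normalizations: the fourth power of the tetrad factor, whose
  square is \<open>Om^2 / (2 w)\<close>, and \<open>1 / sqrt P\<close> from each of \<open>m\<close>
  and its conjugate.\<close>

definition Psi2_ext :: "real^4 \<Rightarrow> complex" where
  "Psi2_ext x = of_real ((Om x)^4 / (4 * (w x)\<^sup>2 * P x)) * weyl_contract ef x (Mbh x) (Nh x) (Lh x) (Mh x)"

lemma Psi2_eq:
  assumes x: "x \<in> V"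
  shows "weyl_Psi2 a m q \<Lambda> \<alpha> x = Psi2_ext x"
proof -
  define k where "k = tetrad_factor a \<alpha> x"
  define sP where "sP = sqrt (P x)"
  define sQ where "sQ = sqrt (Q x)"
  have pos: "P x > 0" "Q x > 0" "w x > 0"
    using x U_pos by (auto simp: in_V)
  then have sq: "sP > 0" "sQ > 0" "P x = sP\<^sup>2" "Q x = sQ\<^sup>2"
    by (simp_all add: sP_def sQ_def)
  have k2: "k\<^sup>2 = of_real ((Om x)\<^sup>2 / (2 * w x))"
    using pos by (simp add: k_def tetrad_factor_def Om_def[symmetric] rho_eq power_divide power_mult_distrib
        flip: of_real_power of_real_mult)
  have c: "akn_P a m q \<Lambda> \<alpha> (x $ 3) = sP\<^sup>2" "akn_Q a m q \<Lambda> \<alpha> (x $ 2) = sQ\<^sup>2" "sin (x $ 3) = s x" "(x $ 2)\<^sup>2 + a\<^sup>2 = b x"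
    using sq by (simp_all add: P_def Q_def s_def b_def)
  note defs = vector_4_eq_iff ef.complex_mult_vec_K c k_def[symmetric] Let_def
  have m: "tetrad_m a m q \<Lambda> \<alpha> x = complex_mult_vec (ef.K x) ((k / of_real sP) *s Mh x)"
    unfolding defs tetrad_m_def Mh_def using sq by (simp add: c field_simps power2_eq_square)
  have mb: "tetrad_mbar a m q \<Lambda> \<alpha> x = complex_mult_vec (ef.K x) ((k / of_real sP) *s Mbh x)"
    unfolding defs tetrad_m_def tetrad_mbar_def Mbh_def using sq
    by (simp add: c field_simps power2_eq_square) (simp add: k_def tetrad_factor_def)
  have l: "tetrad_l a m q \<Lambda> \<alpha> x = complex_mult_vec (ef.K x) ((k * of_real sQ) *s Lh x)"
    unfolding defs tetrad_l_def Lh_def using sq by (simp add: c field_simps power2_eq_square)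
  \<comment> \<open>The shear adds \<open>b / Q\<close> and \<open>a / Q\<close> times the
    r-component \<open>- Q\<close>, which accounts for the factors 2 in \<open>Nh\<close>:
    \<open>2 b - b = b\<close> and \<open>2 a - a = a\<close>.\<close>
  have n: "tetrad_n a m q \<Lambda> \<alpha> x = complex_mult_vec (ef.K x) ((k / of_real sQ) *s Nh x)"
    unfolding defs tetrad_n_def Nh_def using sq by (simp add: c field_simps power2_eq_square)
  have "weyl_Psi2 a m q \<Lambda> \<alpha> x = weyl_contract g x (tetrad_mbar a m q \<Lambda> \<alpha> x)
     (tetrad_n a m q \<Lambda> \<alpha> x) (tetrad_l a m q \<Lambda> \<alpha> x) (tetrad_m a m q \<Lambda> \<alpha> x)"
    by (simp add: weyl_Psi2_def weyl_contract_def)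
  also have "\<dots> = (k / of_real sP) * (k / of_real sQ) * (k * of_real sQ) * (k / of_real sP)
      * weyl_contract ef x (Mbh x) (Nh x) (Lh x) (Mh x)"
    unfolding m mb l n ef.weyl_contract_h[OF x, symmetric] weyl_contract_scale ..
  also have "(k / of_real sP) * (k / of_real sQ) * (k * of_real sQ) * (k / of_real sP) = (k\<^sup>2)\<^sup>2 / of_real (P x)"
    using sq by (simp add: power2_eq_square field_simps)
  also have "\<dots> = of_real ((Om x)^4 / (4 * (w x)\<^sup>2 * P x))"
    by (simp add: k2 power_divide power_mult_distrib)
  finally show ?thesis
    by (simp add: Psi2_ext_def)
qed

lemma rt_Psi2_ext: "complex_rt_smooth U Psi2_ext"
proof -
  have *: "complex_rt_smooth U (\<lambda>x. Mbh x $ i)" "complex_rt_smooth U (\<lambda>x. Mh x $ i)"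
    "complex_rt_smooth U (\<lambda>x. Nh x $ i)" "complex_rt_smooth U (\<lambda>x. Lh x $ i)" for i
    using exhaust_4[of i] U_nz
    by (auto simp: complex_rt_smooth_def Mbh_def Mh_def Nh_def Lh_def intro!: rt_smooth_intros rt_basic)
  have "rt_smooth U (\<lambda>x. (Om x)^4 / (4 * (w x)\<^sup>2 * P x))"
    using U_nz by (auto intro!: rt_smooth_intros rt_basic)
  then show ?thesis
    unfolding Psi2_ext_def[abs_def]
    by (intro complex_rt_smooth_mult complex_rt_smooth_of_real complex_rt_smooth_weyl_contract
        open_U rt_ef rt_ef_inv *)
qed

section \<open>The Page-Shoom invariant at the horizon\<close>

definition jac :: "real^4 \<Rightarrow> real" where
  "jac x = partial 2 (\<lambda>y. Re (Psi2_ext y)) x * partial 3 (\<lambda>y. Im (Psi2_ext y)) x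
     - partial 3 (\<lambda>y. Re (Psi2_ext y)) x * partial 2 (\<lambda>y. Im (Psi2_ext y)) x"

lemma rt_jac: "rt_smooth U jac"
  using rt_Psi2_ext unfolding jac_def[abs_def] complex_rt_smooth_def
  by (intro rt_smooth_diff rt_smooth.mult rt_smooth_partial[OF open_U]) auto

text \<open>For a function and its conjugate the complex Jacobian is \<open>- 2 \<i> jac\<close>.
  Its square, times the 1/2 of the norm and the two diagonal entries of the inverse metric, gives
  the coefficient -2 and the factor \<open>Q\<close>.\<close>

lemma page_shoom_W_eq:
  assumes x: "x \<in> V"
  shows "page_shoom_W a m q \<Lambda> \<alpha> x = of_real (- 2 * (Om x)^4 * Q x * P x / (w x)\<^sup>2 * (jac x)\<^sup>2)"
proof -
  let ?A = "\<lambda>y. Re (Psi2_ext y)" and ?C = "\<lambda>y. Im (Psi2_ext y)"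
  have AC: "rt_smooth V ?A" "rt_smooth V ?C"
    using rt_Psi2_ext VU rt_smooth_mono unfolding complex_rt_smooth_def by blast+
  have f: "partial i (weyl_Psi2 a m q \<Lambda> \<alpha>) x = Complex (partial i ?A x) (partial i ?C x)" for i
    by (rule partial_complex[OF open_V AC x]) (simp add: Psi2_eq)
  have mC: "partial i (\<lambda>y. - ?C y) x = - partial i ?C x" for i
    using partial_rt_mult[OF open_V rt_smooth.const[of V "-1"] AC(2) x, of i] by (simp add: partial_def)
  have h: "partial i (\<lambda>y. cnj (weyl_Psi2 a m q \<Lambda> \<alpha> y)) x = Complex (partial i ?A x) (- partial i ?C x)" for i
    unfolding mC[symmetric]
    by (rule partial_complex[OF open_V AC(1) rt_smooth_uminus[OF AC(2)] x]) (simp add: Psi2_eq complex_eq_iff)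
  note z = rt_smooth_partial_1_4[OF open_V AC(1) x] rt_smooth_partial_1_4[OF open_V AC(2) x]
  have gi: "matrix_inv (g x) $ 2 $ 2 = (Om x)\<^sup>2 * Q x / w x" "matrix_inv (g x) $ 3 $ 3 = (Om x)\<^sup>2 * P x / w x"
    "matrix_inv (g x) $ 2 $ 3 = 0" "matrix_inv (g x) $ 3 $ 2 = 0"
    by (simp_all add: g_inverse[OF x] g_core_inv_def)
  have c0: "Complex 0 0 = 0" by (simp add: complex_eq_iff)
  show ?thesis
    unfolding page_shoom_W_def wedge_norm2_def grad_prod_def f h sum_4 gi z
    using V_nz[OF x]
    by (simp add: c0 complex_eq_iff jac_def power2_eq_square) (simp add: field_simps power4_eq_xxxx)
qed

text \<open>The right-hand side of the preceding formula is continuous on all of \<open>U\<close>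
  and carries the factor \<open>Q\<close>; on \<open>V\<close> it is the invariant itself.\<close>

lemma page_shoom_W_tendsto:
  assumes x0: "x0 \<in> U" and Q0: "Q x0 = 0"
  shows "(page_shoom_W a m q \<Lambda> \<alpha> \<longlongrightarrow> 0) (at x0 within V)"
proof -
  let ?H = "\<lambda>x. - 2 * (Om x)^4 * Q x * P x / (w x)\<^sup>2 * (jac x)\<^sup>2"
  have "rt_smooth U ?H"
    using U_nz by (auto intro!: rt_smooth_intros rt_basic rt_jac)
  then have "isCont ?H x0"
    using rt_smooth_isCont[OF open_U] x0 by blast
  then have "(?H \<longlongrightarrow> 0) (at x0)"
    unfolding isCont_def by (simp add: Q0)
  then have "((\<lambda>x. complex_of_real (?H x)) \<longlongrightarrow> of_real 0) (at x0 within V)"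
    by (intro tendsto_of_real) (rule tendsto_within_subset, auto)
  moreover have "\<forall>\<^sub>F x in at x0 within V. complex_of_real (?H x) = page_shoom_W a m q \<Lambda> \<alpha> x"
    unfolding eventually_at_filter using page_shoom_W_eq by (auto intro!: always_eventually)
  ultimately show ?thesis
    using Lim_transform_eventually by fastforce
qed

section \<open>The spin coefficients at the horizon\<close>

lemma g_zero: "g x $ 1 $ 2 = 0" "g x $ 2 $ 1 = 0" "g x $ 1 $ 3 = 0" "g x $ 3 $ 1 = 0" "g x $ 2 $ 3 = 0"
   "g x $ 3 $ 2 = 0" "g x $ 2 $ 4 = 0" "g x $ 4 $ 2 = 0" "g x $ 3 $ 4 = 0" "g x $ 4 $ 3 = 0" "g x $ 4 $ 1 = g x $ 1 $ 4"
  by (simp_all add: g_eq g_core_def)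

text \<open>\<open>Y\<close> has no r-component and the fields are independent of t and phi, so only
  the theta-derivatives of \<open>\<omega>\<close> survive, with an imaginary factor. Of the
  connection terms only those with upper index r remain, and they are real. \<open>X\<close> and
  \<open>Y\<close> are kept general, so that \<open>m\<close> and its conjugate may be exchanged by
  the sign of \<open>B\<close>.\<close>

lemma spin_contraction:
  fixes c :: "4 \<Rightarrow> real^4 \<Rightarrow> real"
  assumes x: "x \<in> V" and c: "\<And>k. rt_smooth V (c k)" and c3: "\<And>y. c 3 y = 0"
    and \<omega>: "\<And>y k. y \<in> V \<Longrightarrow> \<omega> y $ k = of_real (c k y)"
    and X: "X = vector [of_real M1, 0, \<i> * of_real B, of_real M4]"
    and Y: "Y = vector [of_real M1, 0, - \<i> * of_real B, of_real M4]"
  shows "(\<Sum>k\<in>UNIV. \<Sum>l\<in>UNIV. X $ k * Y $ l * cov_deriv g \<omega> x l k) =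
    Complex (1/2 * ((Om x)\<^sup>2 * Q x / w x) * c 2 x *
        (M1\<^sup>2 * partial 2 (\<lambda>y. g y $ 1 $ 1) x + 2 * M1 * M4 * partial 2 (\<lambda>y. g y $ 1 $ 4) x
         + M4\<^sup>2 * partial 2 (\<lambda>y. g y $ 4 $ 4) x + B\<^sup>2 * partial 2 (\<lambda>y. g y $ 3 $ 3) x))
      (- B * (M1 * partial 3 (c 1) x + M4 * partial 3 (c 4) x))"
proof -
  have p0: "partial i (\<lambda>x. 0 :: real) x = 0" for i
    by (simp add: partial_def)
  have gd: "partial i (\<lambda>y. g y $ j $ k) x = 0" if "i = 1 \<or> i = 4" for i j k
    using that rt_g rt_smooth_partial_1_4[OF open_V _ x] by (auto simp: rt_matrix_def)
  have cd: "partial 1 (c k) x = 0" "partial 4 (c k) x = 0" "partial i (c 3) x = 0" for i k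
    using rt_smooth_partial_1_4[OF open_V c x] by (auto simp: c3 partial_def)
  have dw: "partial i (\<lambda>y. \<omega> y $ k) x = of_real (partial i (c k) x)" for i k
  proof -
    have "partial i (\<lambda>y. \<omega> y $ k) x = Complex (partial i (c k) x) (partial i (\<lambda>_. 0) x)"
      by (rule partial_complex[OF open_V c rt_smooth.const x]) (simp add: \<omega> complex_eq_iff)
    then show ?thesis
      by (simp add: p0 complex_eq_iff)
  qed
  have gi: "matrix_inv (g x) $ 1 $ 2 = 0" "matrix_inv (g x) $ 1 $ 3 = 0" "matrix_inv (g x) $ 4 $ 2 = 0"
    "matrix_inv (g x) $ 4 $ 3 = 0" "matrix_inv (g x) $ 2 $ 1 = 0" "matrix_inv (g x) $ 2 $ 3 = 0"
    "matrix_inv (g x) $ 2 $ 4 = 0" "matrix_inv (g x) $ 2 $ 2 = (Om x)\<^sup>2 * Q x / w x"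
    by (simp_all add: g_inverse[OF x] g_core_inv_def)
  have sym: "christoffel g x s i j = christoffel g x s j i" for s i j
    using exhaust_4[of i] exhaust_4[of j]
    by (elim disjE; simp add: christoffel_def g_zero algebra_simps)
  have G0: "christoffel g x s l k = 0" if "s = 1 \<or> s = 4" "l = 1 \<or> l = 4" "k = 1 \<or> k = 4" for s l k
    using that by (elim disjE; simp add: christoffel_def sum_4 gi gd g_zero p0)
  have G33: "christoffel g x s 3 3 = 0" if "s = 1 \<or> s = 4" for s
    using that by (elim disjE; simp add: christoffel_def sum_4 gi gd g_zero p0)
  have G23: "christoffel g x 2 3 k = 0" "christoffel g x 2 k 3 = 0" if "k = 1 \<or> k = 4" for k
    using that by (elim disjE; simp add: christoffel_def sum_4 gi gd g_zero p0)+
  have G2: "christoffel g x 2 l k = - 1/2 * ((Om x)\<^sup>2 * Q x / w x) * partial 2 (\<lambda>y. g y $ l $ k) x"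
    if "l = 1 \<or> l = 4" "k = 1 \<or> k = 4" for l k
    using that by (elim disjE; simp add: christoffel_def sum_4 gi gd g_zero p0)
  have G233: "christoffel g x 2 3 3 = - 1/2 * ((Om x)\<^sup>2 * Q x / w x) * partial 2 (\<lambda>y. g y $ 3 $ 3) x"
    by (simp add: christoffel_def sum_4 gi gd g_zero p0)
  \<comment> \<open>For \<open>A\<close> = 1 or 4, \<open>X $ A * Y $ 3 + X $ 3 * Y $ A = 0\<close>,
    so by symmetry the connection terms mixing theta with t or phi cancel.\<close>
  note sy = sym[of _ 1 3] sym[of _ 4 3]
  show ?thesis
    unfolding cov_deriv_def dw X Y
    by (simp add: sum_4 \<omega>[OF x] c3 cd G0 G33 G23 G2 G233 g_zero sy)
      (simp add: complex_eq_iff algebra_simps power2_eq_square add_divide_distrib)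
qed

text \<open>\<open>kf\<close> is the tetrad factor, and \<open>M1\<close>, \<open>M4\<close>,
  \<open>Bf\<close> make up the components of \<open>m\<close>. \<open>sqrt Q * Af\<close> is the
  coefficient of \<open>dt - a sin^2 dphi\<close> in the covectors of \<open>l\<close> and
  \<open>n\<close>.\<close>

definition kf :: "real^4 \<Rightarrow> real" where "kf x = - Om x / (sqrt 2 * sqrt (w x))"
definition Af :: "real^4 \<Rightarrow> real" where "Af x = 1 / (sqrt 2 * sqrt (w x) * Om x)"
definition M1 :: "real^4 \<Rightarrow> real" where "M1 x = kf x * a * s x / sqrt (P x)"
definition M4 :: "real^4 \<Rightarrow> real" where "M4 x = kf x / (sqrt (P x) * s x)"
definition Bf :: "real^4 \<Rightarrow> real" where "Bf x = kf x * sqrt (P x)"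

definition spin_re :: "real^4 \<Rightarrow> real" where
  "spin_re x = 1/2 * kf x * ((M1 x)\<^sup>2 * partial 2 (\<lambda>y. g y $ 1 $ 1) x
     + 2 * M1 x * M4 x * partial 2 (\<lambda>y. g y $ 1 $ 4) x
     + (M4 x)\<^sup>2 * partial 2 (\<lambda>y. g y $ 4 $ 4) x + (Bf x)\<^sup>2 * partial 2 (\<lambda>y. g y $ 3 $ 3) x)"

definition spin_im :: "real^4 \<Rightarrow> real" where
  "spin_im x = - Bf x * (M1 x * partial 3 Af x + M4 x * partial 3 (\<lambda>y. - a * (s y)\<^sup>2 * Af y) x)"

text \<open>\<open>cov 1\<close> and \<open>cov (- 1)\<close> are the covectors of \<open>l\<close> and \<open>n\<close>.\<close>

definition cov :: "real \<Rightarrow> 4 \<Rightarrow> real^4 \<Rightarrow> real" where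
  "cov \<epsilon> k x = (if k = 1 then sqrt (Q x) * Af x else if k = 4 then sqrt (Q x) * (- a * (s x)\<^sup>2 * Af x)
     else if k = 2 then - \<epsilon> * sqrt (w x) / (sqrt 2 * Om x * sqrt (Q x)) else 0)"

lemma rt_aux:
  "rt_smooth U kf" "rt_smooth U Af" "rt_smooth U M1" "rt_smooth U M4" "rt_smooth U Bf"
proof -
  show k: "rt_smooth U kf" and "rt_smooth U Af"
    unfolding kf_def[abs_def] Af_def[abs_def] using U_pos U_nz
    by (auto intro!: rt_smooth_intros rt_basic)
  show "rt_smooth U M1" "rt_smooth U M4" "rt_smooth U Bf"
    unfolding M1_def[abs_def] M4_def[abs_def] Bf_def[abs_def] using U_pos U_nz k
    by (auto intro!: rt_smooth_intros rt_basic)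
qed

lemma rt_cov: "rt_smooth V (cov \<epsilon> k)"
proof -
  have pos: "x \<in> V \<Longrightarrow> Q x > 0" "x \<in> V \<Longrightarrow> w x > 0" "x \<in> V \<Longrightarrow> Om x \<noteq> 0" for x
    using U_pos V_nz(1) by (auto simp: in_V)
  have A: "rt_smooth V Af"
    using rt_aux(2) VU by (rule rt_smooth_mono)
  show ?thesis
    using exhaust_4[of k] V_nz
    by (elim disjE; simp add: cov_def[abs_def])
      (auto intro!: rt_smooth_intros rt_basic A simp: pos)
qed

text \<open>Of the entries of \<open>g\<close> only the rr entry divides by \<open>Q\<close>, and
  \<open>spin_re\<close> does not contain it; hence the regularity on \<open>U\<close> and not
  merely on \<open>V\<close>.\<close>

lemma rt_spin: "rt_smooth U spin_re" "rt_smooth U spin_im"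
proof -
  have gs: "rt_smooth U (\<lambda>y. g y $ 1 $ 1)" "rt_smooth U (\<lambda>y. g y $ 1 $ 4)" "rt_smooth U (\<lambda>y. g y $ 4 $ 4)"
      "rt_smooth U (\<lambda>y. g y $ 3 $ 3)"
    unfolding g_eq g_core_def using U_nz by (auto intro!: rt_smooth_intros rt_basic)
  show "rt_smooth U spin_re"
    unfolding spin_re_def[abs_def]
    by (intro rt_smooth_intros rt_aux rt_smooth_partial[OF open_U] gs)
  show "rt_smooth U spin_im"
    unfolding spin_im_def[abs_def]
    by (intro rt_smooth_intros rt_aux rt_smooth_partial[OF open_U] rt_basic)
qed

lemma lower_index_tetrad:
  assumes x: "x \<in> V"
  shows "lower_index g (tetrad_l a m q \<Lambda> \<alpha>) x $ k = of_real (cov 1 k x)"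
    "lower_index g (tetrad_n a m q \<Lambda> \<alpha>) x $ k = of_real (cov (- 1) k x)"
proof -
  define sQ sw where "sQ = sqrt (Q x)" and "sw = sqrt (w x)"
  have pos: "Q x > 0" "w x > 0" "Om x > 0"
    using x U_pos by (auto simp: in_V)
  then have sq: "sQ > 0" "sw > 0" "Q x = sQ\<^sup>2" "w x = sw\<^sup>2"
    by (simp_all add: sQ_def sw_def)
  have c: "akn_Q a m q \<Lambda> \<alpha> (x $ 2) = sQ\<^sup>2" "(x $ 2)\<^sup>2 + a\<^sup>2 = sw\<^sup>2 + a\<^sup>2 * (s x)\<^sup>2"
    using sq b_eq[of x] by (simp_all add: Q_def b_def)
  have tf: "tetrad_factor a \<alpha> x = of_real (- Om x / (sqrt 2 * sw))"
    by (simp add: tetrad_factor_def Om_def[symmetric] rho_eq sw_def)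
  have gv: "lower_index g X x $ k = of_real (\<Sum>j\<in>UNIV. g x $ k $ j * (- Om x / (sqrt 2 * sw) * v $ j))"
    if "X x = tetrad_factor a \<alpha> x *s (\<chi> j. of_real (v $ j))" for X v
    using that by (simp add: lower_index_def tf)
  have l: "tetrad_l a m q \<Lambda> \<alpha> x = tetrad_factor a \<alpha> x *s (\<chi> j. of_real
      ((vector [(sw\<^sup>2 + a\<^sup>2 * (s x)\<^sup>2) / sQ, sQ, 0, a / sQ] :: real^4) $ j))"
    unfolding tetrad_l_def Let_def c using sq by (simp add: vector_4_eq_iff)
  have n: "tetrad_n a m q \<Lambda> \<alpha> x = tetrad_factor a \<alpha> x *s (\<chi> j. of_real
      ((vector [(sw\<^sup>2 + a\<^sup>2 * (s x)\<^sup>2) / sQ, - sQ, 0, a / sQ] :: real^4) $ j))"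
    unfolding tetrad_n_def Let_def c using sq by (simp add: vector_4_eq_iff)
  note gc = g_eq g_core_def sum_4 cov_def Af_def b_eq sQ_def[symmetric] sw_def[symmetric]
  show "lower_index g (tetrad_l a m q \<Lambda> \<alpha>) x $ k = of_real (cov 1 k x)"
    unfolding gv[of "tetrad_l a m q \<Lambda> \<alpha>", OF l] of_real_eq_iff
    using exhaust_4[of k] pos(3) sq(1,2) V_nz(3)[OF x]
    by (elim disjE; simp add: gc sq(3,4); simp add: field_simps power2_eq_square power4_eq_xxxx)
  show "lower_index g (tetrad_n a m q \<Lambda> \<alpha>) x $ k = of_real (cov (- 1) k x)"
    unfolding gv[of "tetrad_n a m q \<Lambda> \<alpha>", OF n] of_real_eq_iff
    using exhaust_4[of k] pos(3) sq(1,2) V_nz(3)[OF x]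
    by (elim disjE; simp add: gc sq(3,4); simp add: field_simps power2_eq_square power4_eq_xxxx)
qed

lemma spin_eq:
  assumes x: "x \<in> V"
  shows "spin_rho a m q \<Lambda> \<alpha> x = of_real (sqrt (Q x)) * Complex (spin_re x) (spin_im x)" (is "?r = ?c")
    and "spin_mu a m q \<Lambda> \<alpha> x = of_real (sqrt (Q x)) * Complex (spin_re x) (spin_im x)" (is "?m = ?c")
proof -
  have pos: "Q x > 0" "P x > 0" "w x > 0" "Om x > 0"
    using x U_pos by (auto simp: in_V)
  have tf: "tetrad_factor a \<alpha> x = of_real (kf x)"
    by (simp add: tetrad_factor_def kf_def Om_def[symmetric] rho_eq)
  have c: "akn_P a m q \<Lambda> \<alpha> (x $ 3) = P x" "sin (x $ 3) = s x"
    by (simp_all add: P_def s_def)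
  have mv: "tetrad_m a m q \<Lambda> \<alpha> x = vector [of_real (M1 x), 0, \<i> * of_real (Bf x), of_real (M4 x)]"
    by (simp add: tetrad_m_def Let_def vector_4_eq_iff tf c M1_def M4_def Bf_def)
  then have mbv: "tetrad_mbar a m q \<Lambda> \<alpha> x = vector [of_real (M1 x), 0, - \<i> * of_real (Bf x), of_real (M4 x)]"
    by (simp add: tetrad_mbar_def vector_4_eq_iff)
  have c3: "cov \<epsilon> 3 y = 0" for \<epsilon> y
    by (simp add: cov_def)
  have A: "rt_smooth V Af"
    using rt_aux(2) VU by (rule rt_smooth_mono)
  have sQ: "rt_smooth V (\<lambda>x. sqrt (Q x))"
    by (intro rt_smooth.sqrt rt_basic) (simp add: in_V)
  have Q3: "partial 3 (\<lambda>x. sqrt (Q x)) x = 0"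
    unfolding Q_def by (rule partial_3_radial)
  have d1: "partial 3 (cov \<epsilon> 1) x = sqrt (Q x) * partial 3 Af x" for \<epsilon>
    unfolding cov_def[abs_def] using partial_rt_mult[OF open_V sQ A x, of 3] Q3 by simp
  have d4: "partial 3 (cov \<epsilon> 4) x = sqrt (Q x) * partial 3 (\<lambda>y. - a * (s y)\<^sup>2 * Af y) x" for \<epsilon>
  proof -
    have "rt_smooth V (\<lambda>y. - a * (s y)\<^sup>2 * Af y)"
      by (intro rt_smooth_intros rt_basic A)
    from partial_rt_mult[OF open_V sQ this x, of 3] Q3 show ?thesis
      unfolding cov_def[abs_def] by simp
  qed
  \<comment> \<open>The covector component contains \<open>1 / sqrt Q\<close>, but raising the index
    supplies a factor \<open>Q\<close>.\<close>
  have c2: "(Om x)\<^sup>2 * Q x / w x * cov \<epsilon> 2 x = \<epsilon> * kf x * sqrt (Q x)" for \<epsilon>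
  proof -
    define sQ sw where "sQ = sqrt (Q x)" "sw = sqrt (w x)"
    have "Q x = sQ\<^sup>2" "w x = sw\<^sup>2" "sQ > 0" "sw > 0"
      using pos by (simp_all add: sQ_sw_def)
    then show ?thesis
      using pos by (simp add: cov_def kf_def flip: sQ_sw_def) (simp add: field_simps power2_eq_square)
  qed
  have E: "Complex (1/2 * ((Om x)\<^sup>2 * Q x / w x) * cov \<epsilon> 2 x * E) (- B * (M1 x * partial 3 (cov \<epsilon> 1) x + M4 x * partial 3 (cov \<epsilon> 4) x))
    = of_real (sqrt (Q x)) * Complex (1/2 * \<epsilon> * kf x * E)
        (- B * (M1 x * partial 3 Af x + M4 x * partial 3 (\<lambda>y. - a * (s y)\<^sup>2 * Af y) x))" for \<epsilon> B E
    unfolding mult.assoc[of "1/2"] c2 d1 d4 by (simp add: complex_eq_iff algebra_simps)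
  have "?r = Complex (1/2 * ((Om x)\<^sup>2 * Q x / w x) * cov 1 2 x *
        ((M1 x)\<^sup>2 * partial 2 (\<lambda>y. g y $ 1 $ 1) x + 2 * M1 x * M4 x * partial 2 (\<lambda>y. g y $ 1 $ 4) x
         + (M4 x)\<^sup>2 * partial 2 (\<lambda>y. g y $ 4 $ 4) x + (Bf x)\<^sup>2 * partial 2 (\<lambda>y. g y $ 3 $ 3) x))
      (- Bf x * (M1 x * partial 3 (cov 1 1) x + M4 x * partial 3 (cov 1 4) x))"
    unfolding spin_rho_def Let_def
    by (rule spin_contraction[OF x rt_cov c3 lower_index_tetrad(1) mv mbv])
  then show "?r = ?c"
    by (simp only: E) (simp add: spin_re_def spin_im_def)
  \<comment> \<open>Exchanging \<open>m\<close> and its conjugate is the replacement of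
    \<open>Bf\<close> by \<open>- Bf\<close>. This sign in the imaginary part and the sign of
    \<open>cov (- 1) 2\<close> in the real part are both undone by the minus in
    \<open>spin_mu\<close>.\<close>
  have mbv': "tetrad_mbar a m q \<Lambda> \<alpha> x = vector [of_real (M1 x), 0, \<i> * of_real (- Bf x), of_real (M4 x)]"
    and mv': "tetrad_m a m q \<Lambda> \<alpha> x = vector [of_real (M1 x), 0, - \<i> * of_real (- Bf x), of_real (M4 x)]"
    by (simp_all add: mv mbv)
  have "?m = - Complex (1/2 * ((Om x)\<^sup>2 * Q x / w x) * cov (- 1) 2 x *
        ((M1 x)\<^sup>2 * partial 2 (\<lambda>y. g y $ 1 $ 1) x + 2 * M1 x * M4 x * partial 2 (\<lambda>y. g y $ 1 $ 4) x
         + (M4 x)\<^sup>2 * partial 2 (\<lambda>y. g y $ 4 $ 4) x + (- Bf x)\<^sup>2 * partial 2 (\<lambda>y. g y $ 3 $ 3) x))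
      (- (- Bf x) * (M1 x * partial 3 (cov (- 1) 1) x + M4 x * partial 3 (cov (- 1) 4) x))"
    unfolding spin_mu_def Let_def
    by (rule arg_cong[of _ _ uminus], rule spin_contraction[OF x rt_cov c3 lower_index_tetrad(2) mbv' mv'])
  then show "?m = ?c"
    by (simp only: E) (simp add: spin_re_def spin_im_def complex_eq_iff algebra_simps)
qed

text \<open>The class admits \<open>sqrt\<close> of positive functions only, so the product is not
  placed in it at the horizon; continuity of the root at 0 and of the cofactor suffices.\<close>

lemma spin_tendsto:
  assumes Q0: "akn_Q a m q \<Lambda> \<alpha> r0 = 0" and x0: "vector [t, r0, \<theta>, \<phi>] \<in> U"
    and f: "\<And>x. x \<in> V \<Longrightarrow> f x = of_real (sqrt (Q x)) * Complex (spin_re x) (spin_im x)"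
  shows "((\<lambda>r. f (vector [t, r, \<theta>, \<phi>])) \<longlongrightarrow> 0) (at r0 within {r. akn_Q a m q \<Lambda> \<alpha> r > 0})"
proof -
  let ?\<gamma> = "\<lambda>r. vector [t, r, \<theta>, \<phi>] :: real^4"
  have g: "(?\<gamma> \<longlongrightarrow> ?\<gamma> r0) (at r0)"
  proof (rule vec_tendstoI)
    fix i
    show "((\<lambda>r. ?\<gamma> r $ i) \<longlongrightarrow> ?\<gamma> r0 $ i) (at r0)"
      using exhaust_4[of i] by (auto intro: tendsto_ident_at)
  qed
  have R: "((\<lambda>r. h (?\<gamma> r)) \<longlongrightarrow> h (?\<gamma> r0)) (at r0)" if "rt_smooth U h" for h
    using isCont_tendsto_compose[OF rt_smooth_isCont[OF open_U that x0] g] .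
  have "((\<lambda>r. of_real (sqrt (Q (?\<gamma> r))) * Complex (spin_re (?\<gamma> r)) (spin_im (?\<gamma> r))) \<longlongrightarrow>
     of_real (sqrt (Q (?\<gamma> r0))) * Complex (spin_re (?\<gamma> r0)) (spin_im (?\<gamma> r0))) (at r0)"
    by (intro tendsto_intros R rt_spin rt_basic)
  then have lim: "((\<lambda>r. of_real (sqrt (Q (?\<gamma> r))) * Complex (spin_re (?\<gamma> r)) (spin_im (?\<gamma> r))) \<longlongrightarrow> 0)
     (at r0 within {r. akn_Q a m q \<Lambda> \<alpha> r > 0})"
    using Q0 by (auto simp: Q_def intro: tendsto_within_subset)
  \<comment> \<open>Openness keeps the radial line in \<open>U\<close> near the horizon; with
    \<open>Q > 0\<close> it lies in \<open>V\<close>, where the formula for \<open>f\<close>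
    holds.\<close>
  have "\<forall>\<^sub>F r in at r0. ?\<gamma> r \<in> U"
    using topological_tendstoD[OF g open_U x0] .
  then have "\<forall>\<^sub>F r in at r0 within {r. akn_Q a m q \<Lambda> \<alpha> r > 0}. ?\<gamma> r \<in> U"
    by (rule filter_leD[OF at_le, rotated]) simp
  moreover have "\<forall>\<^sub>F r in at r0 within {r. akn_Q a m q \<Lambda> \<alpha> r > 0}. akn_Q a m q \<Lambda> \<alpha> r > 0"
    by (auto simp: eventually_at_filter)
  ultimately have "\<forall>\<^sub>F r in at r0 within {r. akn_Q a m q \<Lambda> \<alpha> r > 0}.
      of_real (sqrt (Q (?\<gamma> r))) * Complex (spin_re (?\<gamma> r)) (spin_im (?\<gamma> r)) = f (?\<gamma> r)"
    by eventually_elim (simp add: f in_V Q_def)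
  with lim show ?thesis
    by (rule Lim_transform_eventually)
qed

end

text \<open>The spin coefficients converge along radial lines; the invariant converges within the
  whole tetrad domain, as its extension by continuity demands.\<close>

theorem corollary58:
  fixes a m q \<Lambda> \<alpha> :: real
  shows "(\<forall>x \<in> akn_tetrad_domain a m q \<Lambda> \<alpha>. spin_mu a m q \<Lambda> \<alpha> x = spin_rho a m q \<Lambda> \<alpha> x)
    \<and> (\<forall>t r\<^sub>0 \<theta> \<phi>. akn_Q a m q \<Lambda> \<alpha> r\<^sub>0 = 0 \<and> vector [t, r\<^sub>0, \<theta>, \<phi>] \<in> akn_domain a m q \<Lambda> \<alpha> \<longrightarrow>
        ((\<lambda>r. spin_mu a m q \<Lambda> \<alpha> (vector [t, r, \<theta>, \<phi>])) \<longlongrightarrow> 0)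
          (at r\<^sub>0 within {r. akn_Q a m q \<Lambda> \<alpha> r > 0})
        \<and> ((\<lambda>r. spin_rho a m q \<Lambda> \<alpha> (vector [t, r, \<theta>, \<phi>])) \<longlongrightarrow> 0)
          (at r\<^sub>0 within {r. akn_Q a m q \<Lambda> \<alpha> r > 0})
        \<and> (page_shoom_W a m q \<Lambda> \<alpha> \<longlongrightarrow> 0)
          (at (vector [t, r\<^sub>0, \<theta>, \<phi>]) within akn_tetrad_domain a m q \<Lambda> \<alpha>))"
proof -
  interpret akn_spacetime a m q \<Lambda> \<alpha> .
  show ?thesis
  proof (intro conjI ballI allI impI; (elim conjE)?)
    fix x assume "x \<in> V"
    then show "spin_mu a m q \<Lambda> \<alpha> x = spin_rho a m q \<Lambda> \<alpha> x"
      by (simp add: spin_eq)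
  next
    fix t r0 \<theta> \<phi> :: real
    assume Q0: "akn_Q a m q \<Lambda> \<alpha> r0 = 0" and x0: "vector [t, r0, \<theta>, \<phi>] \<in> U"
    show "((\<lambda>r. spin_mu a m q \<Lambda> \<alpha> (vector [t, r, \<theta>, \<phi>])) \<longlongrightarrow> 0) (at r0 within {r. akn_Q a m q \<Lambda> \<alpha> r > 0})"
      by (rule spin_tendsto[OF Q0 x0 spin_eq(2)])
    show "((\<lambda>r. spin_rho a m q \<Lambda> \<alpha> (vector [t, r, \<theta>, \<phi>])) \<longlongrightarrow> 0) (at r0 within {r. akn_Q a m q \<Lambda> \<alpha> r > 0})"
      by (rule spin_tendsto[OF Q0 x0 spin_eq(1)])
    show "(page_shoom_W a m q \<Lambda> \<alpha> \<longlongrightarrow> 0) (at (vector [t, r0, \<theta>, \<phi>]) within V)"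
      by (rule page_shoom_W_tendsto[OF x0]) (simp add: Q_def Q0)
  qed
qed

end
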